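(* Let $v(\sigma,t)$ be a sufficiently smooth real function on $\mathbb{R}\times[0,T]$, $2\pi$-periodic in $\sigma$, with $\int_0^{2\pi}v(\sigma,t)\,d\sigma=0$, satisfying $$\frac{\partial v}{\partial t}+\frac{\delta}{R^4}\frac{\partial^4v}{\partial\sigma^4}+\frac1{R^2}\Big(\alpha-1+\frac{\delta}{R^2}\Big)\frac{\partial^2v}{\partial\sigma^2}+\frac{\alpha-1}{R^2}v-\frac{v_c}{R^2}v\frac{\partial v}{\partial\sigma}=0,\qquad R=R(t),$$ and let $M>0$ be a constant with $\sup_{0\le t\le T}\|\partial v/\partial\sigma(\cdot,t)\|_\infty\le M$. Let $\boldsymbol v^n\in\mathbb{R}^J_{\mathrm{per}}$, $v^n_i=v(\sigma_i,t^n)$. Suppose $\boldsymbol V^0=\boldsymbol v^0$ and $\boldsymbol V^1,\dots,\boldsymbol V^N\in\mathbb{R}^J_{\mathrm{per}}$ satisfy the Crank--Nicolson scheme $$\frac1k(\boldsymbol V^{n+1}-\boldsymbol V^n)+\mathcal L_h^{n+\frac12}\boldsymbol V^{n+\frac12}=\frac{v_c}{6hR_{n+\frac12}^2}\boldsymbol\varphi(\boldsymbol V^{n+\frac12},\boldsymbol V^{n+\frac12}),\qquad n=0,\dots,N-1,$$ where $\boldsymbol V^{n+\frac12}=\frac12(\boldsymbol V^n+\boldsymbol V^{n+1})$. Then, for a sufficiently small $k$, there exists a constant $c=c(\delta,\alpha,R_0,M)$, independent of $k$ and $h$, such that $$\max_{0\le n\le N}\|\boldsymbol v^n-\boldsymbol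 V^n\|_h\le c\,(k^2+h^2).$$
   Context: Constants and radius: $\delta>0$, $\alpha>0$, $v_c\in\mathbb{R}$, $T>0$. $R:[0,T]\to(0,\infty)$ is a given solution of $\dot R=v_c+(\alpha-1)/R$, $R(0)=R_0>0$, which is expanding ($\dot R>0$). Grid: $J,N\in\mathbb{N}$, $h=2\pi/J$, $\sigma_i=ih$ ($i\in\mathbb{Z}$), $k=T/N$, $t^n=nk$; $R_m=R(mk)$ for integer or half-integer $m$. $\mathbb{R}^J_{\mathrm{per}}=\{\boldsymbol V=(V_i)_{i\in\mathbb{Z}}: V_i\in\mathbb{R},\ V_{i+J}=V_i\}$, with norm $\|\boldsymbol V\|_h=(h\sum_{i=1}^JV_i^2)^{1/2}$. For $\boldsymbol V,\boldsymbol W\in\mathbb{R}^J_{\mathrm{per}}$: $\Delta_hV_i=h^{-2}(V_{i-1}-2V_i+V_{i+1})$, $\Delta_h^2V_i=h^{-2}(\Delta_hV_{i-1}-2\Delta_hV_i+\Delta_hV_{i+1})$, $$(\mathcal L_h^m\boldsymbol V)_i=\frac{\delta}{R_m^4}\Delta_h^2V_i+\frac1{R_m^2}\Big(\alpha-1+\frac{\delta}{R_m^2}\Big)\Delta_hV_i+\frac{\alpha-1}{R_m^2}V_i,$$ $$(\boldsymbol\varphi(\boldsymbol V,\boldsymbol W))_i=(V_{i-1}+V_i+V_{i+1})(W_{i+1}-W_{i-1}).$$ Standing assumption: the discrete means vanish, $h\sum_{i=1}^JV^n_i=0$ for $0\le n\le N$ (in particular $h\sum_{i=1}^Jv^0_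i=0$).
   Formalization: The constant c depends, besides δ, α, R_0 and M, also on T and on a bound for the partial derivatives of v up to order 6 ("sufficiently smooth" is read as C^6 on the closed strip); with dependence on δ, α, R_0, M alone the claim is false. *)

theory Defs
  imports "HOL-Analysis.Analysis"
begin

text \<open>Functions \<open>v \<sigma> t\<close> are considered for \<open>\<sigma>\<close> real and \<open>0 \<le> t \<le> T\<close>; values at other times are
  irrelevant. Time derivatives are therefore taken within \<open>{0..T}\<close>, i.e. one-sided at the two ends.\<close>

definition dsigma :: "(real \<Rightarrow> real \<Rightarrow> real) \<Rightarrow> real \<Rightarrow> real \<Rightarrow> real" where
  "dsigma v \<sigma> t = deriv (\<lambda>s. v s t) \<sigma>"

definition dtime :: "real \<Rightarrow> (real \<Rightarrow> real \<Rightarrow> real) \<Rightarrow> real \<Rightarrow> real \<Rightarrow> real" where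
  "dtime T v \<sigma> t = vector_derivative (\<lambda>s. v \<sigma> s) (at t within {0..T})"

text \<open>\<open>v\<close> is of class \<open>C\<^sup>p\<close> on the closed strip: all partial derivatives of order at most \<open>p\<close>, in any
  order of differentiation, exist and are jointly continuous.\<close>

primrec C_class :: "nat \<Rightarrow> real \<Rightarrow> (real \<Rightarrow> real \<Rightarrow> real) \<Rightarrow> bool" where
  "C_class 0 T v \<longleftrightarrow> continuous_on (UNIV \<times> {0..T}) (\<lambda>(\<sigma>, t). v \<sigma> t)"
| "C_class (Suc p) T v \<longleftrightarrow>
     continuous_on (UNIV \<times> {0..T}) (\<lambda>(\<sigma>, t). v \<sigma> t) \<and>
     (\<forall>\<sigma>. \<forall>t\<in>{0..T}. (\<lambda>s. v s t) differentiable (at \<sigma>) \<and>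
                      (\<lambda>s. v \<sigma> s) differentiable (at t within {0..T})) \<and>
     C_class p T (dsigma v) \<and> C_class p T (dtime T v)"

text \<open>All partial derivatives of order at most \<open>p\<close> are bounded by \<open>K\<close> on the strip.\<close>

primrec C_bound :: "nat \<Rightarrow> real \<Rightarrow> real \<Rightarrow> (real \<Rightarrow> real \<Rightarrow> real) \<Rightarrow> bool" where
  "C_bound 0 T K v \<longleftrightarrow> (\<forall>\<sigma>. \<forall>t\<in>{0..T}. \<bar>v \<sigma> t\<bar> \<le> K)"
| "C_bound (Suc p) T K v \<longleftrightarrow>
     (\<forall>\<sigma>. \<forall>t\<in>{0..T}. \<bar>v \<sigma> t\<bar> \<le> K) \<and> C_bound p T K (dsigma v) \<and> C_bound p T K (dtime T v)"

text \<open>The truncation error of the scheme involves partial derivatives of order at most 6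
  (namely \<open>\<partial>\<^sub>\<sigma>\<^sup>6 v\<close> and \<open>\<partial>\<^sub>\<sigma>\<^sup>4 \<partial>\<^sub>t\<^sup>2 v\<close>); this fixes the meaning of ``sufficiently smooth''.\<close>

abbreviation smoothness_order :: nat where
  "smoothness_order \<equiv> 6"

definition expanding_radius ::
    "real \<Rightarrow> real \<Rightarrow> real \<Rightarrow> real \<Rightarrow> (real \<Rightarrow> real) \<Rightarrow> bool" where
  "expanding_radius \<alpha> vc R0 T R \<longleftrightarrow>
     R 0 = R0 \<and>
     (\<forall>t\<in>{0..T}. R t > 0 \<and>
        (R has_real_derivative (vc + (\<alpha> - 1) / R t)) (at t within {0..T}) \<and>
        vc + (\<alpha> - 1) / R t > 0)"

definition exact_solution ::
    "real \<Rightarrow> real \<Rightarrow> real \<Rightarrow> real \<Rightarrow> (real \<Rightarrow> real) \<Rightarrow> (real \<Rightarrow> real \<Rightarrow> real) \<Rightarrow> bool" where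
  "exact_solution \<delta> \<alpha> vc T R v \<longleftrightarrow>
     C_class smoothness_order T v \<and>
     (\<forall>\<sigma>. \<forall>t\<in>{0..T}. v (\<sigma> + 2 * pi) t = v \<sigma> t) \<and>
     (\<forall>t\<in>{0..T}. integral {0..2 * pi} (\<lambda>\<sigma>. v \<sigma> t) = 0) \<and>
     (\<forall>\<sigma>. \<forall>t\<in>{0..T}.
        dtime T v \<sigma> t
        + \<delta> / R t ^ 4 * (dsigma ^^ 4) v \<sigma> t
        + 1 / (R t)\<^sup>2 * (\<alpha> - 1 + \<delta> / (R t)\<^sup>2) * (dsigma ^^ 2) v \<sigma> t
        + (\<alpha> - 1) / (R t)\<^sup>2 * v \<sigma> t
        - vc / (R t)\<^sup>2 * v \<sigma> t * dsigma v \<sigma> t = 0)"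

definition mesh :: "nat \<Rightarrow> real" where
  "mesh J = 2 * pi / real J"

definition periodic_grid :: "nat \<Rightarrow> (int \<Rightarrow> real) set" where
  "periodic_grid J = {V. \<forall>i. V (i + int J) = V i}"

definition norm_h :: "nat \<Rightarrow> (int \<Rightarrow> real) \<Rightarrow> real" where
  "norm_h J V = sqrt (mesh J * (\<Sum>i=1..int J. (V i)\<^sup>2))"

definition mean_h :: "nat \<Rightarrow> (int \<Rightarrow> real) \<Rightarrow> real" where
  "mean_h J V = mesh J * (\<Sum>i=1..int J. V i)"

definition lap :: "real \<Rightarrow> (int \<Rightarrow> real) \<Rightarrow> int \<Rightarrow> real" where
  "lap h V i = (V (i - 1) - 2 * V i + V (i + 1)) / h\<^sup>2"

text \<open>The operator \<open>L\<^sub>h\<close>, with \<open>r\<close> the radius at the time considered.\<close>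

definition L_h :: "real \<Rightarrow> real \<Rightarrow> real \<Rightarrow> real \<Rightarrow> (int \<Rightarrow> real) \<Rightarrow> int \<Rightarrow> real" where
  "L_h \<delta> \<alpha> h r V i =
     \<delta> / r ^ 4 * lap h (lap h V) i
     + 1 / r\<^sup>2 * (\<alpha> - 1 + \<delta> / r\<^sup>2) * lap h V i
     + (\<alpha> - 1) / r\<^sup>2 * V i"

definition phi :: "(int \<Rightarrow> real) \<Rightarrow> (int \<Rightarrow> real) \<Rightarrow> int \<Rightarrow> real" where
  "phi V W i = (V (i - 1) + V i + V (i + 1)) * (W (i + 1) - W (i - 1))"

definition midpoint_avg :: "(nat \<Rightarrow> int \<Rightarrow> real) \<Rightarrow> nat \<Rightarrow> int \<Rightarrow> real" where
  "midpoint_avg V n i = (V n i + V (Suc n) i) / 2"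

definition crank_nicolson ::
    "real \<Rightarrow> real \<Rightarrow> real \<Rightarrow> real \<Rightarrow> (real \<Rightarrow> real) \<Rightarrow> nat \<Rightarrow> nat \<Rightarrow> (nat \<Rightarrow> int \<Rightarrow> real) \<Rightarrow> bool" where
  "crank_nicolson \<delta> \<alpha> vc T R J N V \<longleftrightarrow>
     (let h = mesh J; k = T / real N in
      \<forall>n<N. let r = R ((real n + 1 / 2) * k); Vm = midpoint_avg V n in
        \<forall>i. 1 / k * (V (Suc n) i - V n i) + L_h \<delta> \<alpha> h r Vm i
              = vc / (6 * h * r\<^sup>2) * phi Vm Vm i)"

definition grid_values :: "(real \<Rightarrow> real \<Rightarrow> real) \<Rightarrow> real \<Rightarrow> nat \<Rightarrow> nat \<Rightarrow> nat \<Rightarrow> int \<Rightarrow> real" where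
  "grid_values v T J N n i = v (of_int i * mesh J) (real n * (T / real N))"

end

theory Submission
  imports Defs
begin

text \<open>
  Energy method. Tested with the error at the half step, the fourth-order part of \<open>L\<^sub>h\<close> absorbs the
  second-order part by Young's inequality, and in the nonlinear term the contribution cubic in the
  error cancels, leaving \<open>3 M \<bar>vc\<bar> / (2 R\<^sup>2)\<close> times the squared norm of the error. The truncation error is
  \<open>O((1 + \<bar>vc\<bar> / R\<^sup>2) (k\<^sup>2 + h\<^sup>2))\<close>. Gronwall's inequality is applied with the weights
  \<open>k (1 + \<bar>vc\<bar> / R\<^sup>2)\<close>: as \<open>R\<close> expands, their sum is bounded independently of \<open>vc\<close>, whereas each
  single weight is small only for small \<open>k\<close> depending on \<open>vc\<close>.
\<close>

section \<open>Sums over a period\<close>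

text \<open>The obstacle is \<open>vc\<close>: it multiplies the nonlinear term and hence part of
  the truncation error, and the final constant has to be chosen before it. Replacing
  \<open>\<bar>vc\<bar> / R\<^sup>2\<close> by \<open>\<bar>vc\<bar> / R0\<^sup>2\<close> would put
  \<open>vc\<close> into the exponent of the Gronwall factor. But a large positive \<open>vc\<close>
  also makes the radius grow fast: up to a bounded term, \<open>vc / R\<^sup>2\<close> is the rate
  at which \<open>1 / R\<close> decreases, and the total decrease of \<open>1 / R\<close> is at most
  \<open>1 / R0\<close>. Since the growth rate and the truncation error carry the same factor, one
  sum of weights controls both. The cubic cancellation rests on the three-point sum in
  \<open>phi\<close>: \<open>phi e e i\<close> is \<open>e i * (e (i + 1) - e (i - 1))\<close> plus
  \<open>(e (i + 1))\<^sup>2 - (e (i - 1))\<^sup>2\<close>. These discretise the product of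
  \<open>e\<close> and its derivative in two ways. Neither is orthogonal to \<open>e\<close> in
  general, but their sums against \<open>e\<close> are opposite.\<close>

lemma periodic_gridD: "V \<in> periodic_grid J \<Longrightarrow> V (i + int J) = V i"
  by (simp add: periodic_grid_def)

lemma periodic_grid_shift:
  assumes "V \<in> periodic_grid J"
  shows "(\<lambda>i. V (i + c)) \<in> periodic_grid J"
proof -
  have "V (i + int J + c) = V (i + c)" for i
    using periodic_gridD[OF assms, of "i + c"] by (simp add: algebra_simps)
  then show ?thesis by (simp add: periodic_grid_def)
qed

lemma sum_periodic_Suc:
  assumes "f \<in> periodic_grid J"
  shows "(\<Sum>i=1..int J. f (i + 1)) = (\<Sum>i=1..int J. f i)"
proof -
  have "(\<Sum>i=1..int J. f (i + 1)) = (\<Sum>i\<in>(\<lambda>i. i + 1) ` {1..int J}. f i)"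
    by (subst sum.reindex) (auto simp: inj_on_def)
  also have "(\<lambda>i::int. i + 1) ` {1..int J} = {2..int J + 1}"
    using image_add_atLeastAtMost[of "1::int" 1 "int J"] by (simp add: add.commute)
  finally have *: "(\<Sum>i=1..int J. f (i + 1)) = sum f {2..int J + 1}" .
  show ?thesis
  proof (cases "J = 0")
    case False
    have "{1..int J} = insert 1 {2..int J}" "{2..int J + 1} = insert (int J + 1) {2..int J}"
      using False by auto
    moreover have "f (int J + 1) = f 1"
      using periodic_gridD[OF assms, of 1] by (simp add: add.commute)
    ultimately show ?thesis using * by simp
  qed auto
qed

lemma sum_periodic_shift:
  assumes "f \<in> periodic_grid J"
  shows "(\<Sum>i=1..int J. f (i - 1)) = (\<Sum>i=1..int J. f i)"
  using sum_periodic_Suc[OF periodic_grid_shift[OF assms, of "-1"]] by simp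

lemma periodic_grid_lap:
  assumes "V \<in> periodic_grid J"
  shows "lap h V \<in> periodic_grid J"
proof -
  have "V (i + int J - 1) = V (i - 1)" "V (i + int J + 1) = V (i + 1)" "V (i + int J) = V i" for i
    using periodic_gridD[OF assms, of "i - 1"] periodic_gridD[OF assms, of "i + 1"]
      periodic_gridD[OF assms, of i]
    by (simp_all add: algebra_simps)
  then show ?thesis by (simp add: periodic_grid_def lap_def)
qed

lemma periodic_grid_mult:
  "U \<in> periodic_grid J \<Longrightarrow> V \<in> periodic_grid J \<Longrightarrow> (\<lambda>i. U i * V i) \<in> periodic_grid J"
  by (simp add: periodic_grid_def)

text \<open>Every summation by parts below reduces to this shift; periodicity leaves no boundary
  terms.\<close>

lemma sum_shift_mult:
  assumes "U \<in> periodic_grid J" "V \<in> periodic_grid J"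
  shows "(\<Sum>i=1..int J. U (i - 1) * V i) = (\<Sum>i=1..int J. U i * V (i + 1))"
  using sum_periodic_shift[OF periodic_grid_mult[OF assms(1) periodic_grid_shift[OF assms(2), of 1]]]
  by simp

lemma sum_lap_mult:
  assumes "U \<in> periodic_grid J" "V \<in> periodic_grid J"
  shows "(\<Sum>i=1..int J. lap h U i * V i) = (\<Sum>i=1..int J. U i * lap h V i)"
proof -
  have "(\<Sum>i=1..int J. lap h U i * V i)
      = ((\<Sum>i=1..int J. U (i - 1) * V i) - 2 * (\<Sum>i=1..int J. U i * V i)
          + (\<Sum>i=1..int J. V i * U (i + 1))) / h\<^sup>2"
    unfolding lap_def sum_distrib_left sum.distrib[symmetric] sum_subtractf[symmetric]
      sum_divide_distrib
    by (intro sum.cong) (auto simp: algebra_simps diff_divide_distrib add_divide_distrib)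
  also have "\<dots> = ((\<Sum>i=1..int J. U i * V (i + 1)) - 2 * (\<Sum>i=1..int J. U i * V i)
          + (\<Sum>i=1..int J. V (i - 1) * U i)) / h\<^sup>2"
    by (simp add: sum_shift_mult assms)
  also have "\<dots> = (\<Sum>i=1..int J. U i * lap h V i)"
    unfolding lap_def sum_distrib_left sum.distrib[symmetric] sum_subtractf[symmetric]
      sum_divide_distrib
    by (intro sum.cong) (auto simp: algebra_simps diff_divide_distrib add_divide_distrib)
  finally show ?thesis .
qed

section \<open>Energy estimates\<close>

text \<open>Completing the square in \<open>x / r\<^sup>2\<close>. The powers of \<open>r\<close>
  match exactly, so that the loss \<open>\<beta>\<^sup>2 / (4 * \<delta>)\<close> contains
  \<open>r\<close> at most through \<open>\<beta>\<close>.\<close>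

lemma young_lower_bound:
  fixes \<delta> \<beta> r x y :: real
  assumes "\<delta> > 0" "r \<noteq> 0"
  shows "\<delta> / r ^ 4 * x\<^sup>2 + \<beta> / r\<^sup>2 * x * y \<ge> - (\<beta>\<^sup>2 / (4 * \<delta>)) * y\<^sup>2"
proof -
  have "0 \<le> \<delta> * (x / r\<^sup>2 + \<beta> * y / (2 * \<delta>))\<^sup>2"
    using assms by simp
  also have "\<dots> = \<delta> / r ^ 4 * x\<^sup>2 + \<beta> / r\<^sup>2 * x * y + \<beta>\<^sup>2 / (4 * \<delta>) * y\<^sup>2"
    using assms by (simp add: field_simps power2_eq_square power4_eq_xxxx)
  finally show ?thesis by simp
qed

text \<open>A discrete Garding inequality: moving one Laplacian onto \<open>e\<close> turns the
  fourth-order term into squares of \<open>lap h e\<close>, which pay for the indefinite term. All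
  radii are replaced by \<open>R0\<close>, so one constant serves every time step.\<close>

lemma L_h_coercive:
  assumes e: "e \<in> periodic_grid J" and "\<delta> > 0" "0 < R0" "R0 \<le> r"
  shows "(\<Sum>i=1..int J. L_h \<delta> \<alpha> h r e i * e i) \<ge>
    - ((\<bar>\<alpha> - 1\<bar> + \<delta> / R0\<^sup>2)\<^sup>2 / (4 * \<delta>) + \<bar>\<alpha> - 1\<bar> / R0\<^sup>2) * (\<Sum>i=1..int J. (e i)\<^sup>2)"
proof -
  define \<beta> where "\<beta> = \<alpha> - 1 + \<delta> / r\<^sup>2"
  have r: "r > 0" using assms by simp
  have r2: "R0\<^sup>2 \<le> r\<^sup>2" using assms by (simp add: power_mono)
  have "\<delta> / r\<^sup>2 \<le> \<delta> / R0\<^sup>2" "0 \<le> \<delta> / r\<^sup>2"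
    using assms r2 r by (auto intro!: divide_left_mono)
  \<comment> \<open>The outer absolute value on the right gives the form that
    \<open>abs_le_square_iff\<close> converts into an inequality of squares.\<close>
  then have "\<bar>\<beta>\<bar> \<le> \<bar>\<bar>\<alpha> - 1\<bar> + \<delta> / R0\<^sup>2\<bar>"
    unfolding \<beta>_def by linarith
  then have \<beta>: "\<beta>\<^sup>2 / (4 * \<delta>) \<le> (\<bar>\<alpha> - 1\<bar> + \<delta> / R0\<^sup>2)\<^sup>2 / (4 * \<delta>)"
    using assms unfolding abs_le_square_iff by (intro divide_right_mono) auto
  have a: "(\<alpha> - 1) / r\<^sup>2 \<ge> - (\<bar>\<alpha> - 1\<bar> / R0\<^sup>2)"
  proof -
    have "\<bar>(\<alpha> - 1) / r\<^sup>2\<bar> \<le> \<bar>\<alpha> - 1\<bar> / R0\<^sup>2"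
      using r2 assms r by (auto simp: abs_divide intro!: divide_left_mono)
    then show ?thesis by linarith
  qed
  have "(\<Sum>i=1..int J. L_h \<delta> \<alpha> h r e i * e i)
      = \<delta> / r ^ 4 * (\<Sum>i=1..int J. lap h (lap h e) i * e i)
        + (\<Sum>i=1..int J. \<beta> / r\<^sup>2 * lap h e i * e i + (\<alpha> - 1) / r\<^sup>2 * (e i)\<^sup>2)"
    unfolding sum_distrib_left sum.distrib[symmetric]
    unfolding L_h_def \<beta>_def[symmetric]
    by (intro sum.cong) (auto simp: algebra_simps power2_eq_square)
  also have "(\<Sum>i=1..int J. lap h (lap h e) i * e i) = (\<Sum>i=1..int J. (lap h e i)\<^sup>2)"
    using sum_lap_mult[OF periodic_grid_lap[OF e] e] by (simp add: power2_eq_square)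
  also have "\<delta> / r ^ 4 * \<dots>
        + (\<Sum>i=1..int J. \<beta> / r\<^sup>2 * lap h e i * e i + (\<alpha> - 1) / r\<^sup>2 * (e i)\<^sup>2)
      = (\<Sum>i=1..int J. \<delta> / r ^ 4 * (lap h e i)\<^sup>2 + \<beta> / r\<^sup>2 * lap h e i * e i
            + (\<alpha> - 1) / r\<^sup>2 * (e i)\<^sup>2)"
    by (simp add: sum_distrib_left sum.distrib algebra_simps)
  also have "\<dots> \<ge> (\<Sum>i=1..int J.
      - ((\<bar>\<alpha> - 1\<bar> + \<delta> / R0\<^sup>2)\<^sup>2 / (4 * \<delta>) + \<bar>\<alpha> - 1\<bar> / R0\<^sup>2) * (e i)\<^sup>2)"
  proof (rule sum_mono)
    fix i
    have "- (\<beta>\<^sup>2 / (4 * \<delta>)) * (e i)\<^sup>2 \<le> \<delta> / r ^ 4 * (lap h e i)\<^sup>2 + \<beta> / r\<^sup>2 * lap h e i * e i"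
      using young_lower_bound[of \<delta> r \<beta> "e i" "lap h e i"] assms r by simp
    moreover have "\<beta>\<^sup>2 / (4 * \<delta>) * (e i)\<^sup>2 \<le> (\<bar>\<alpha> - 1\<bar> + \<delta> / R0\<^sup>2)\<^sup>2 / (4 * \<delta>) * (e i)\<^sup>2"
      using \<beta> by (intro mult_right_mono) auto
    moreover have "- (\<bar>\<alpha> - 1\<bar> / R0\<^sup>2) * (e i)\<^sup>2 \<le> (\<alpha> - 1) / r\<^sup>2 * (e i)\<^sup>2"
      using a by (intro mult_right_mono) auto
    ultimately show "- ((\<bar>\<alpha> - 1\<bar> + \<delta> / R0\<^sup>2)\<^sup>2 / (4 * \<delta>) + \<bar>\<alpha> - 1\<bar> / R0\<^sup>2) * (e i)\<^sup>2
        \<le> \<delta> / r ^ 4 * (lap h e i)\<^sup>2 + \<beta> / r\<^sup>2 * lap h e i * e i + (\<alpha> - 1) / r\<^sup>2 * (e i)\<^sup>2"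
      unfolding distrib_right minus_add_distrib mult_minus_left by linarith
  qed
  finally show ?thesis by (simp add: sum_distrib_left)
qed

section \<open>The nonlinear term tested with the error\<close>

lemma sum_shift_squares:
  assumes "e \<in> periodic_grid J"
  shows "(\<Sum>i=1..int J. (e (i + 1))\<^sup>2) = (\<Sum>i=1..int J. (e i)\<^sup>2)"
    "(\<Sum>i=1..int J. (e (i - 1))\<^sup>2) = (\<Sum>i=1..int J. (e i)\<^sup>2)"
  using sum_periodic_Suc[OF periodic_grid_mult[OF assms assms]]
    sum_periodic_shift[OF periodic_grid_mult[OF assms assms]]
  by (simp_all add: power2_eq_square)

lemma abs_mult_le_half_squares: "\<bar>a * b\<bar> \<le> (a\<^sup>2 + b\<^sup>2) / 2" for a b :: real
proof -
  have "0 \<le> (\<bar>a\<bar> - \<bar>b\<bar>)\<^sup>2" by simp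
  then show ?thesis by (simp add: power2_diff abs_mult)
qed

text \<open>Discrete form of the vanishing integral of \<open>e\<^sup>2\<close> times the derivative
  of \<open>e\<close> over a period: the four cubic products form two pairs, and within each pair
  one product is a shift of the other.\<close>

lemma sum_phi_self:
  assumes e: "e \<in> periodic_grid J"
  shows "(\<Sum>i=1..int J. phi e e i * e i) = 0"
proof -
  have sq: "(\<lambda>i. (e i)\<^sup>2) \<in> periodic_grid J"
    using e by (simp add: periodic_grid_def)
  have "(\<Sum>i=1..int J. phi e e i * e i)
      = ((\<Sum>i=1..int J. e i * (e (i + 1))\<^sup>2) - (\<Sum>i=1..int J. e (i - 1) * (e i)\<^sup>2))
      + ((\<Sum>i=1..int J. (e i)\<^sup>2 * e (i + 1)) - (\<Sum>i=1..int J. (e (i - 1))\<^sup>2 * e i))"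
    unfolding sum.distrib[symmetric] sum_subtractf[symmetric]
    by (intro sum.cong) (auto simp: phi_def algebra_simps power2_eq_square)
  also have "\<dots> = 0"
    using sum_shift_mult[OF e sq] sum_shift_mult[OF sq e] by simp
  finally show ?thesis .
qed

text \<open>Here the difference acts on \<open>v\<close>, so a pointwise estimate suffices: the
  centred difference is at most \<open>2 * d\<close>, and Young's inequality leaves squares with
  total weight 1 + 1 + 4 = 6.\<close>

lemma sum_phi_right:
  assumes e: "e \<in> periodic_grid J" and d: "\<And>i. \<bar>v (i + 1) - v i\<bar> \<le> d"
  shows "\<bar>\<Sum>i=1..int J. phi e v i * e i\<bar> \<le> 6 * d * (\<Sum>i=1..int J. (e i)\<^sup>2)"
proof -
  have d0: "0 \<le> d" using d[of 0] by linarith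
  have "\<bar>\<Sum>i=1..int J. phi e v i * e i\<bar> \<le> (\<Sum>i=1..int J. \<bar>phi e v i * e i\<bar>)"
    by (rule sum_abs)
  also have "\<dots> \<le> (\<Sum>i=1..int J. d * ((e (i - 1))\<^sup>2 + (e (i + 1))\<^sup>2 + 4 * (e i)\<^sup>2))"
  proof (rule sum_mono)
    fix i
    have v: "\<bar>v (i + 1) - v (i - 1)\<bar> \<le> 2 * d"
      using d[of i] d[of "i - 1"] by (simp add: abs_le_iff)
    have "\<bar>(e (i - 1) + e i + e (i + 1)) * e i\<bar>
        \<le> \<bar>e (i - 1) * e i\<bar> + \<bar>e i * e i\<bar> + \<bar>e (i + 1) * e i\<bar>"
      unfolding distrib_right by linarith
    also have "\<dots> \<le> ((e (i - 1))\<^sup>2 + (e (i + 1))\<^sup>2 + 4 * (e i)\<^sup>2) / 2"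
      using abs_mult_le_half_squares[of "e (i - 1)" "e i"] abs_mult_le_half_squares[of "e i" "e i"]
        abs_mult_le_half_squares[of "e (i + 1)" "e i"] by simp
    finally have "\<bar>(e (i - 1) + e i + e (i + 1)) * e i\<bar>
        \<le> ((e (i - 1))\<^sup>2 + (e (i + 1))\<^sup>2 + 4 * (e i)\<^sup>2) / 2" .
    then have "\<bar>v (i + 1) - v (i - 1)\<bar> * \<bar>(e (i - 1) + e i + e (i + 1)) * e i\<bar>
        \<le> (2 * d) * (((e (i - 1))\<^sup>2 + (e (i + 1))\<^sup>2 + 4 * (e i)\<^sup>2) / 2)"
      using v d0 by (intro mult_mono) auto
    moreover have "phi e v i * e i = (v (i + 1) - v (i - 1)) * ((e (i - 1) + e i + e (i + 1)) * e i)"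
      by (simp add: phi_def)
    ultimately show "\<bar>phi e v i * e i\<bar> \<le> d * ((e (i - 1))\<^sup>2 + (e (i + 1))\<^sup>2 + 4 * (e i)\<^sup>2)"
      by (simp only: abs_mult)
  qed
  also have "\<dots> = 6 * d * (\<Sum>i=1..int J. (e i)\<^sup>2)"
    using sum_shift_squares[OF e]
    by (simp add: sum_distrib_left[symmetric] sum.distrib)
  finally show ?thesis .
qed

text \<open>Here the difference acts on \<open>e\<close>, where a pointwise estimate would give no
  factor \<open>d\<close>. Summation by parts moves it to the three-point sum of \<open>v\<close>,
  whose increments are at most \<open>3 * d\<close>.\<close>

lemma sum_phi_left:
  assumes e: "e \<in> periodic_grid J" and v: "v \<in> periodic_grid J"
    and d: "\<And>i. \<bar>v (i + 1) - v i\<bar> \<le> d"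
  shows "\<bar>\<Sum>i=1..int J. phi v e i * e i\<bar> \<le> 3 * d * (\<Sum>i=1..int J. (e i)\<^sup>2)"
proof -
  define s where "s i = v (i - 1) + v i + v (i + 1)" for i
  have d0: "0 \<le> d" using d[of 0] by linarith
  have "s \<in> periodic_grid J"
    using periodic_grid_shift[OF v, of "-1"] periodic_grid_shift[OF v, of 1] v
    by (simp add: periodic_grid_def s_def)
  then have "(\<lambda>i. s i * e i) \<in> periodic_grid J"
    using periodic_grid_mult e by blast
  note shift = sum_shift_mult[OF e this]
  have "(\<Sum>i=1..int J. phi v e i * e i)
      = (\<Sum>i=1..int J. s i * e (i + 1) * e i) - (\<Sum>i=1..int J. e (i - 1) * (s i * e i))"
    unfolding sum_subtractf[symmetric]
    by (intro sum.cong) (auto simp: phi_def s_def algebra_simps)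
  also have "\<dots> = (\<Sum>i=1..int J. (s i - s (i + 1)) * (e i * e (i + 1)))"
    unfolding shift sum_subtractf[symmetric] by (intro sum.cong) (auto simp: algebra_simps)
  also have "\<bar>\<dots>\<bar> \<le> (\<Sum>i=1..int J. \<bar>(s i - s (i + 1)) * (e i * e (i + 1))\<bar>)"
    by (rule sum_abs)
  also have "\<dots> \<le> (\<Sum>i=1..int J. 3 * d * (((e i)\<^sup>2 + (e (i + 1))\<^sup>2) / 2))"
  proof (rule sum_mono)
    fix i
    have "\<bar>s i - s (i + 1)\<bar> \<le> 3 * d"
      using d[of "i - 1"] d[of i] d[of "i + 1"] unfolding s_def
      by (simp add: abs_le_iff algebra_simps)
    then show "\<bar>(s i - s (i + 1)) * (e i * e (i + 1))\<bar> \<le> 3 * d * (((e i)\<^sup>2 + (e (i + 1))\<^sup>2) / 2)"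
      unfolding abs_mult[of "s i - s (i + 1)"]
      using abs_mult_le_half_squares[of "e i" "e (i + 1)"] d0 by (intro mult_mono) auto
  qed
  also have "\<dots> = 3 * d * (\<Sum>i=1..int J. (e i)\<^sup>2)"
    using sum_shift_squares[OF e]
    by (simp add: sum_distrib_left[symmetric] sum_divide_distrib[symmetric] sum.distrib)
  finally show ?thesis .
qed

text \<open>The part cubic in the error drops out, so no a priori bound on \<open>w\<close> is needed.\<close>

lemma sum_phi_diff:
  assumes v: "v \<in> periodic_grid J" and w: "w \<in> periodic_grid J"
    and d: "\<And>i. \<bar>v (i + 1) - v i\<bar> \<le> d"
  shows "\<bar>\<Sum>i=1..int J. (phi v v i - phi w w i) * (v i - w i)\<bar>
    \<le> 9 * d * (\<Sum>i=1..int J. (v i - w i)\<^sup>2)"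
proof -
  define e where "e i = v i - w i" for i
  have e: "e \<in> periodic_grid J" using v w by (simp add: periodic_grid_def e_def)
  \<comment> \<open>Bilinearity with \<open>w = v - e\<close>. The two mixed terms give 3 + 6 =
    9.\<close>
  have "phi v v i - phi w w i = phi v e i + phi e v i - phi e e i" for i
    by (simp add: phi_def e_def algebra_simps)
  then have "(\<Sum>i=1..int J. (phi v v i - phi w w i) * e i)
      = (\<Sum>i=1..int J. phi v e i * e i) + (\<Sum>i=1..int J. phi e v i * e i)
        - (\<Sum>i=1..int J. phi e e i * e i)"
    by (simp only: sum.distrib[symmetric] sum_subtractf[symmetric] distrib_right left_diff_distrib)
  then have "\<bar>\<Sum>i=1..int J. (phi v v i - phi w w i) * e i\<bar> \<le> 9 * d * (\<Sum>i=1..int J. (e i)\<^sup>2)"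
    using sum_phi_self[OF e] sum_phi_right[OF e, of v d, OF d] sum_phi_left[OF e v, of d, OF d]
    by simp
  then show ?thesis by (simp add: e_def)
qed

section \<open>Discrete norm\<close>

text \<open>A scaled \<open>L2_set\<close>, from which the triangle inequality and Cauchy-Schwarz
  are inherited.\<close>

lemma norm_h_L2_set: "norm_h J V = sqrt (mesh J) * L2_set V {1..int J}"
  by (simp add: norm_h_def L2_set_def real_sqrt_mult)

lemma norm_h_nonneg [simp]: "0 \<le> norm_h J V"
  by (simp add: norm_h_def mesh_def sum_nonneg)

lemma norm_h_square: "(norm_h J V)\<^sup>2 = mesh J * (\<Sum>i=1..int J. (V i)\<^sup>2)"
  by (simp add: norm_h_def mesh_def sum_nonneg)

lemma norm_h_average_le: "norm_h J (\<lambda>i. (U i + V i) / 2) \<le> (norm_h J U + norm_h J V) / 2"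
proof -
  have "L2_set (\<lambda>i. (U i + V i) / 2) {1..int J} = L2_set (\<lambda>i. U i + V i) {1..int J} / 2"
    using L2_set_right_distrib[of "1/2" "\<lambda>i. U i + V i" "{1..int J}"] by (simp add: add_divide_distrib)
  then have "L2_set (\<lambda>i. (U i + V i) / 2) {1..int J}
      \<le> (L2_set U {1..int J} + L2_set V {1..int J}) / 2"
    using L2_set_triangle_ineq[of U V "{1..int J}"] by simp
  then have "sqrt (mesh J) * L2_set (\<lambda>i. (U i + V i) / 2) {1..int J}
      \<le> sqrt (mesh J) * ((L2_set U {1..int J} + L2_set V {1..int J}) / 2)"
    by (intro mult_left_mono) (simp_all add: mesh_def)
  then show ?thesis
    by (simp add: norm_h_L2_set distrib_left add_divide_distrib)
qed

lemma inner_h_le: "mesh J * (\<Sum>i=1..int J. U i * V i) \<le> norm_h J U * norm_h J V"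
proof -
  have m: "0 \<le> mesh J" by (simp add: mesh_def)
  have "(\<Sum>i=1..int J. U i * V i) \<le> (\<Sum>i=1..int J. \<bar>U i\<bar> * \<bar>V i\<bar>)"
    by (intro sum_mono) (metis abs_ge_self abs_mult)
  also have "\<dots> \<le> L2_set U {1..int J} * L2_set V {1..int J}"
    by (rule L2_set_mult_ineq)
  finally have "mesh J * (\<Sum>i=1..int J. U i * V i)
      \<le> (sqrt (mesh J) * sqrt (mesh J)) * (L2_set U {1..int J} * L2_set V {1..int J})"
    using m by (simp add: mult_left_mono)
  then show ?thesis by (simp only: norm_h_L2_set mult_ac)
qed

text \<open>The \<open>J\<close> cells of width \<open>mesh J\<close> cover one period, whose length
  \<open>2 * pi\<close> yields the factor.\<close>

lemma norm_h_le_of_bound: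
  assumes "\<And>i. \<bar>V i\<bar> \<le> B" "J > 0"
  shows "norm_h J V \<le> sqrt (2 * pi) * B"
proof -
  have B: "0 \<le> B" using assms(1)[of 0] by linarith
  have "(V i)\<^sup>2 \<le> B\<^sup>2" for i
    using assms(1)[of i] B by (metis abs_le_square_iff abs_of_nonneg)
  then have "(\<Sum>i=1..int J. (V i)\<^sup>2) \<le> (\<Sum>i=1..int J. B\<^sup>2)"
    by (intro sum_mono)
  then have "mesh J * (\<Sum>i=1..int J. (V i)\<^sup>2) \<le> 2 * pi * B\<^sup>2"
    using assms(2) by (simp add: mesh_def field_simps)
  then have "norm_h J V \<le> sqrt (2 * pi * B\<^sup>2)"
    unfolding norm_h_def by simp
  then show ?thesis using B by (simp add: real_sqrt_mult)
qed

text \<open>Testing with the mean of the old and the new error produces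
  \<open>(a 1)\<^sup>2 - (a 0)\<^sup>2\<close>, which has the factor \<open>a 0 + a 1\<close>. The
  norm of that mean is at most \<open>(a 0 + a 1) / 2\<close>, so the right-hand side acquires the
  same factor. Dividing by it leaves an estimate linear in the norms and in \<open>B\<close>, which
  preserves the order of the truncation error.\<close>

lemma energy_step:
  assumes v: "\<And>j. j \<le> 1 \<Longrightarrow> v j \<in> periodic_grid J" and V: "\<And>j. j \<le> 1 \<Longrightarrow> V j \<in> periodic_grid J"
    and params: "\<delta> > 0" "0 < R0" "R0 \<le> r" "k > 0" "J > 0"
    and scheme: "\<And>i. 1 / k * (V 1 i - V 0 i) + L_h \<delta> \<alpha> (mesh J) r (midpoint_avg V 0) i
              = vc / (6 * mesh J * r\<^sup>2) * phi (midpoint_avg V 0) (midpoint_avg V 0) i"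
    and exact: "\<And>i. 1 / k * (v 1 i - v 0 i) + L_h \<delta> \<alpha> (mesh J) r (midpoint_avg v 0) i
              = vc / (6 * mesh J * r\<^sup>2) * phi (midpoint_avg v 0) (midpoint_avg v 0) i + \<tau> i"
    and lip: "\<And>i. \<bar>midpoint_avg v 0 (i + 1) - midpoint_avg v 0 i\<bar> \<le> M * mesh J"
    and tau: "\<And>i. \<bar>\<tau> i\<bar> \<le> B"
  defines "a \<equiv> \<lambda>j. norm_h J (\<lambda>i. v j i - V j i)"
  shows "a 1 - a 0 \<le> k * (((\<bar>\<alpha> - 1\<bar> + \<delta> / R0\<^sup>2)\<^sup>2 / (4 * \<delta>) + \<bar>\<alpha> - 1\<bar> / R0\<^sup>2)
      + 3 / 2 * M * \<bar>vc\<bar> / r\<^sup>2) * ((a 0 + a 1) / 2) + k * (sqrt (2 * pi) * B)"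
proof -
  define h where "h = mesh J"
  have h: "h > 0" using params by (simp add: h_def mesh_def)
  have r: "r > 0" using params by simp
  define vm where "vm = midpoint_avg v 0"
  define wm where "wm = midpoint_avg V 0"
  define C where "C = (\<bar>\<alpha> - 1\<bar> + \<delta> / R0\<^sup>2)\<^sup>2 / (4 * \<delta>) + \<bar>\<alpha> - 1\<bar> / R0\<^sup>2"
  define e where "e i = vm i - wm i" for i
  define S where "S = (\<Sum>i=1..int J. (e i)\<^sup>2)"
  have S0: "S \<ge> 0" by (simp add: S_def sum_nonneg)
  have vmp: "vm \<in> periodic_grid J" and wmp: "wm \<in> periodic_grid J"
    using v[of 0] v[of 1] V[of 0] V[of 1]
    by (simp_all add: vm_def wm_def midpoint_avg_def periodic_grid_def)
  then have ep: "e \<in> periodic_grid J" by (simp add: e_def periodic_grid_def)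
  have Le: "L_h \<delta> \<alpha> h r vm i - L_h \<delta> \<alpha> h r wm i = L_h \<delta> \<alpha> h r e i" for i
  proof -
    have "lap h e = (\<lambda>i. lap h vm i - lap h wm i)"
      by (auto simp: fun_eq_iff lap_def e_def diff_divide_distrib add_divide_distrib algebra_simps)
    moreover have "lap h (\<lambda>i. lap h vm i - lap h wm i) i = lap h (lap h vm) i - lap h (lap h wm) i"
      by (simp add: lap_def[of h _ i] diff_divide_distrib add_divide_distrib algebra_simps)
    ultimately show ?thesis
      by (simp add: L_h_def e_def right_diff_distrib del: times_divide_eq_left)
  qed
  have err: "(v 1 i - V 1 i) - (v 0 i - V 0 i)
      = k * (vc / (6 * h * r\<^sup>2) * (phi vm vm i - phi wm wm i) + \<tau> i - L_h \<delta> \<alpha> h r e i)" for i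
  proof -
    have "1 / k * (v 1 i - v 0 i) - 1 / k * (V 1 i - V 0 i)
      = vc / (6 * h * r\<^sup>2) * (phi vm vm i - phi wm wm i) + \<tau> i - L_h \<delta> \<alpha> h r e i"
      using scheme[of i] exact[of i] Le[of i]
      unfolding h_def[symmetric] vm_def[symmetric] wm_def[symmetric] right_diff_distrib by linarith
    moreover have "(v 1 i - V 1 i) - (v 0 i - V 0 i)
      = k * (1 / k * (v 1 i - v 0 i) - 1 / k * (V 1 i - V 0 i))"
      using params by (simp add: right_diff_distrib)
    ultimately show ?thesis by simp
  qed
  have "(a 1)\<^sup>2 - (a 0)\<^sup>2
      = h * (\<Sum>i=1..int J. (v 1 i - V 1 i)\<^sup>2 - (v 0 i - V 0 i)\<^sup>2)"
    by (simp add: a_def norm_h_square h_def sum_subtractf right_diff_distrib)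
  also have "\<dots> = h * (\<Sum>i=1..int J. 2 * (e i * ((v 1 i - V 1 i) - (v 0 i - V 0 i))))"
    by (intro arg_cong2[where f="(*)"] sum.cong)
      (auto simp: e_def vm_def wm_def midpoint_avg_def power2_eq_square field_simps)
  also have "\<dots> = 2 * k * (vc / (6 * r\<^sup>2) * (\<Sum>i=1..int J. (phi vm vm i - phi wm wm i) * e i)
      + h * (\<Sum>i=1..int J. \<tau> i * e i) - h * (\<Sum>i=1..int J. L_h \<delta> \<alpha> h r e i * e i))"
  proof -
    have "h * (2 * (e i * ((v 1 i - V 1 i) - (v 0 i - V 0 i))))
      = 2 * k * (vc / (6 * r\<^sup>2) * ((phi vm vm i - phi wm wm i) * e i)
      + h * (\<tau> i * e i) - h * (L_h \<delta> \<alpha> h r e i * e i))" for i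
      unfolding err using h r by (simp add: field_simps)
    then show ?thesis
      by (simp only: sum_distrib_left sum.distrib[symmetric] sum_subtractf[symmetric])
  qed
  also have "\<dots> \<le> 2 * k * (3 / 2 * M * \<bar>vc\<bar> / r\<^sup>2 * (h * S) + sqrt (2 * pi) * B * norm_h J e + C * (h * S))"
  proof -
    \<comment> \<open>The \<open>1 / h\<close> of the scheme was absorbed by the \<open>h\<close> of
      the squared norm; the increment bound \<open>M * h\<close> now supplies the \<open>h\<close>
      in \<open>h * S\<close>. The rate becomes 9 / 6 = 3 / 2.\<close>
    have "\<bar>\<Sum>i=1..int J. (phi vm vm i - phi wm wm i) * e i\<bar> \<le> 9 * (M * h) * S"
      using sum_phi_diff[OF vmp wmp, of "M * h"] lip unfolding e_def S_def vm_def h_def by simp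
    then have "\<bar>vc / (6 * r\<^sup>2)\<bar> * \<bar>\<Sum>i=1..int J. (phi vm vm i - phi wm wm i) * e i\<bar>
        \<le> \<bar>vc / (6 * r\<^sup>2)\<bar> * (9 * (M * h) * S)"
      by (intro mult_left_mono) auto
    then have "vc / (6 * r\<^sup>2) * (\<Sum>i=1..int J. (phi vm vm i - phi wm wm i) * e i)
        \<le> \<bar>vc / (6 * r\<^sup>2)\<bar> * (9 * (M * h) * S)"
      unfolding abs_mult[symmetric] by (rule order_trans[OF abs_ge_self])
    also have "\<dots> = 3 / 2 * M * \<bar>vc\<bar> / r\<^sup>2 * (h * S)"
      using r by (simp add: abs_mult field_simps)
    finally have 1: "vc / (6 * r\<^sup>2) * (\<Sum>i=1..int J. (phi vm vm i - phi wm wm i) * e i)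
        \<le> 3 / 2 * M * \<bar>vc\<bar> / r\<^sup>2 * (h * S)" .
    have 2: "h * (\<Sum>i=1..int J. \<tau> i * e i) \<le> sqrt (2 * pi) * B * norm_h J e"
      using inner_h_le[of J \<tau> e] mult_right_mono[OF norm_h_le_of_bound[of \<tau>, OF tau params(5)], of "norm_h J e"]
      unfolding h_def by simp
    have "- C * S \<le> (\<Sum>i=1..int J. L_h \<delta> \<alpha> h r e i * e i)"
      using L_h_coercive[OF ep params(1-3)] by (simp add: S_def C_def)
    from mult_left_mono[OF this, of h] h
    have 3: "- (C * (h * S)) \<le> h * (\<Sum>i=1..int J. L_h \<delta> \<alpha> h r e i * e i)"
      by (simp add: algebra_simps)
    show ?thesis using 1 2 3 params by (intro mult_left_mono) auto
  qed
  also have "\<dots> = 2 * k * ((C + 3 / 2 * M * \<bar>vc\<bar> / r\<^sup>2) * (norm_h J e)\<^sup>2 + sqrt (2 * pi) * B * norm_h J e)"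
    by (simp add: norm_h_square S_def h_def algebra_simps)
  also have "\<dots> \<le> 2 * k * ((C + 3 / 2 * M * \<bar>vc\<bar> / r\<^sup>2) * ((a 0 + a 1) / 2)\<^sup>2
      + sqrt (2 * pi) * B * ((a 0 + a 1) / 2))"
  proof -
    have "e = (\<lambda>i. ((v 0 i - V 0 i) + (v 1 i - V 1 i)) / 2)"
      by (auto simp: fun_eq_iff e_def vm_def wm_def midpoint_avg_def field_simps)
    then have "norm_h J e \<le> (a 0 + a 1) / 2"
      using norm_h_average_le unfolding a_def by simp
    moreover have "0 \<le> M"
    proof -
      have "0 \<le> M * mesh J" using lip[of 0] by linarith
      then show ?thesis using h unfolding h_def by (simp add: zero_le_mult_iff)
    qed
    moreover have "0 \<le> B" using tau[of 0] by linarith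
    moreover have "0 \<le> C" using params by (simp add: C_def)
    ultimately show ?thesis using params
      by (intro mult_left_mono add_mono power_mono) auto
  qed
  also have "\<dots> = (k * (C + 3 / 2 * M * \<bar>vc\<bar> / r\<^sup>2) * ((a 0 + a 1) / 2)
      + k * (sqrt (2 * pi) * B)) * (a 0 + a 1)"
  proof -
    have "2 * k * (L * (x / 2)\<^sup>2 + t * (x / 2)) = (k * L * (x / 2) + k * t) * x" for L t x :: real
      by (simp add: power2_eq_square field_simps)
    then show ?thesis .
  qed
  also have "(a 1)\<^sup>2 - (a 0)\<^sup>2 = (a 1 - a 0) * (a 0 + a 1)"
    by (simp add: power2_eq_square algebra_simps)
  finally have main: "(a 1 - a 0) * (a 0 + a 1)
      \<le> (k * (C + 3 / 2 * M * \<bar>vc\<bar> / r\<^sup>2) * ((a 0 + a 1) / 2) + k * (sqrt (2 * pi) * B)) * (a 0 + a 1)" .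
  have a0: "0 \<le> a 0" "0 \<le> a 1" by (simp_all add: a_def)
  \<comment> \<open>The common factor can be cancelled unless both norms vanish, in which case the
    right-hand side is nonnegative.\<close>
  show ?thesis
  proof (cases "a 0 + a 1 = 0")
    case True
    then have "a 0 = 0" "a 1 = 0" using a0 by linarith+
    moreover have "0 \<le> B" using tau[of 0] by linarith
    ultimately show ?thesis using params by simp
  next
    case False
    then have "a 0 + a 1 > 0" using a0 by linarith
    with main show ?thesis unfolding C_def by (rule mult_right_le_imp_le)
  qed
qed

section \<open>Finite differences\<close>

text \<open>Subtracting the Taylor expansions at \<open>x + d\<close> and \<open>x - d\<close>
  cancels the even terms. Derivatives are taken within a convex set because those in time are
  one-sided at the ends of \<open>{0..T}\<close>. The remainder has the denominator
  \<open>fact 2\<close>, as \<open>field_Taylor\<close> divides by the factorial of the degree of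
  the polynomial.\<close>

lemma central_difference:
  fixes f :: "nat \<Rightarrow> real \<Rightarrow> real"
  assumes S: "convex S" "x - d \<in> S" "x \<in> S" "x + d \<in> S"
    and f: "\<And>i y. y \<in> S \<Longrightarrow> i \<le> 2 \<Longrightarrow> (f i has_field_derivative f (Suc i) y) (at y within S)"
    and K: "\<And>y. y \<in> S \<Longrightarrow> \<bar>f 3 y\<bar> \<le> K" and d: "d > 0"
  shows "\<bar>(f 0 (x + d) - f 0 (x - d)) / (2 * d) - f 1 x\<bar> \<le> K * d\<^sup>2 / 2"
proof -
  have sum2: "(\<Sum>i\<le>2. f i x * s ^ i / fact i) = f 0 x + s * f 1 x + s\<^sup>2 * f 2 x / 2" for s
    by (simp add: numeral_2_eq_2)
  have "\<bar>f 0 (x + d) - (f 0 x + d * f 1 x + d\<^sup>2 * f 2 x / 2)\<bar> \<le> K * d ^ 3 / 2"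
    using field_Taylor[of S 2 f K x "x + d"] assms unfolding sum2 by (simp add: eval_nat_numeral)
  moreover have "\<bar>f 0 (x - d) - (f 0 x - d * f 1 x + d\<^sup>2 * f 2 x / 2)\<bar> \<le> K * d ^ 3 / 2"
    using field_Taylor[of S 2 f K x "x - d"] assms unfolding sum2 by (simp add: eval_nat_numeral)
  ultimately have "\<bar>(f 0 (x + d) - f 0 (x - d)) - 2 * (d * f 1 x)\<bar> \<le> K * d ^ 3"
    by linarith
  then have "\<bar>(f 0 (x + d) - f 0 (x - d)) - 2 * (d * f 1 x)\<bar> / (2 * d) \<le> K * d ^ 3 / (2 * d)"
    using d by (intro divide_right_mono) auto
  moreover have "\<bar>(f 0 (x + d) - f 0 (x - d)) - 2 * (d * f 1 x)\<bar> / (2 * d)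
      = \<bar>((f 0 (x + d) - f 0 (x - d)) - 2 * (d * f 1 x)) / (2 * d)\<bar>"
    using d by (simp add: abs_divide)
  ultimately show ?thesis using d
    by (simp add: diff_divide_distrib power2_eq_square power3_eq_cube)
qed

lemma two_point_average:
  fixes f :: "nat \<Rightarrow> real \<Rightarrow> real"
  assumes S: "convex S" "x - d \<in> S" "x \<in> S" "x + d \<in> S"
    and f: "\<And>i y. y \<in> S \<Longrightarrow> i \<le> 1 \<Longrightarrow> (f i has_field_derivative f (Suc i) y) (at y within S)"
    and K: "\<And>y. y \<in> S \<Longrightarrow> \<bar>f 2 y\<bar> \<le> K"
  shows "\<bar>(f 0 (x - d) + f 0 (x + d)) / 2 - f 0 x\<bar> \<le> K * d\<^sup>2"
proof -
  have "\<bar>f 0 (x + d) - (\<Sum>i\<le>1. f i x * d ^ i / fact i)\<bar> \<le> K * d\<^sup>2"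
    using field_Taylor[of S 1 f K x "x + d"] assms by (simp add: numeral_2_eq_2)
  moreover have "\<bar>f 0 (x - d) - (\<Sum>i\<le>1. f i x * (- d) ^ i / fact i)\<bar> \<le> K * d\<^sup>2"
    using field_Taylor[of S 1 f K x "x - d"] assms by (simp add: numeral_2_eq_2)
  ultimately show ?thesis by (simp add: abs_le_iff field_simps)
qed

text \<open>The operator \<open>lap\<close> for functions of a real variable: in this form it can be
  differentiated and iterated before restriction to the grid.\<close>

definition second_difference :: "real \<Rightarrow> (real \<Rightarrow> real) \<Rightarrow> real \<Rightarrow> real" where
  "second_difference h f x = (f (x - h) - 2 * f x + f (x + h)) / h\<^sup>2"

text \<open>Meant for functions whose second derivative is already small: the quotient then loses no
  power of \<open>h\<close>.\<close>

lemma second_difference_bound: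
  fixes f :: "nat \<Rightarrow> real \<Rightarrow> real"
  assumes f: "\<And>i y. i \<le> 1 \<Longrightarrow> (f i has_real_derivative f (Suc i) y) (at y)"
    and K: "\<And>y. \<bar>f 2 y\<bar> \<le> K" and h: "h > 0"
  shows "\<bar>second_difference h (f 0) x\<bar> \<le> 2 * K"
proof -
  have "\<bar>(f 0 (x - h) + f 0 (x + h)) / 2 - f 0 x\<bar> \<le> K * h\<^sup>2"
    using two_point_average[of UNIV x h f K] f K by simp
  then have "\<bar>(f 0 (x - h) - 2 * f 0 x + f 0 (x + h))\<bar> \<le> 2 * K * h\<^sup>2"
    by (simp add: abs_le_iff field_simps)
  then show ?thesis
    using h by (simp add: second_difference_def abs_divide divide_le_eq)
qed

lemma second_difference_error:
  fixes f :: "nat \<Rightarrow> real \<Rightarrow> real"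
  assumes f: "\<And>i y. i \<le> 3 \<Longrightarrow> (f i has_real_derivative f (Suc i) y) (at y)"
    and K: "\<And>y. \<bar>f 4 y\<bar> \<le> K" and h: "h > 0"
  shows "\<bar>second_difference h (f 0) x - f 2 x\<bar> \<le> K * h\<^sup>2 / 3"
proof -
  have sum3: "(\<Sum>i\<le>3. f i x * s ^ i / fact i)
      = f 0 x + s * f 1 x + s\<^sup>2 * f 2 x / 2 + s ^ 3 * f 3 x / 6" for s
    by (simp add: eval_nat_numeral mult_ac)
  have "\<bar>f 0 (x + h) - (f 0 x + h * f 1 x + h\<^sup>2 * f 2 x / 2 + h ^ 3 * f 3 x / 6)\<bar>
      \<le> K * h ^ 4 / 6"
    using field_Taylor[of UNIV 3 f K x "x + h"] assms unfolding sum3 by (simp add: eval_nat_numeral)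
  moreover have "\<bar>f 0 (x - h) - (f 0 x - h * f 1 x + h\<^sup>2 * f 2 x / 2 - h ^ 3 * f 3 x / 6)\<bar>
      \<le> K * h ^ 4 / 6"
    using field_Taylor[of UNIV 3 f K x "x - h"] assms unfolding sum3 by (simp add: eval_nat_numeral)
  ultimately have "\<bar>f 0 (x - h) - 2 * f 0 x + f 0 (x + h) - h\<^sup>2 * f 2 x\<bar> \<le> K * h ^ 4 / 3"
    by linarith
  then have "\<bar>f 0 (x - h) - 2 * f 0 x + f 0 (x + h) - h\<^sup>2 * f 2 x\<bar> / h\<^sup>2 \<le> K * h ^ 4 / 3 / h\<^sup>2"
    by (intro divide_right_mono) auto
  moreover have "\<bar>f 0 (x - h) - 2 * f 0 x + f 0 (x + h) - h\<^sup>2 * f 2 x\<bar> / h\<^sup>2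
      = \<bar>(f 0 (x - h) - 2 * f 0 x + f 0 (x + h) - h\<^sup>2 * f 2 x) / h\<^sup>2\<bar>"
    by (simp add: abs_divide)
  moreover have "K * h ^ 4 / 3 / h\<^sup>2 = K * h\<^sup>2 / 3"
    using h by (simp add: eval_nat_numeral)
  ultimately show ?thesis
    using h by (simp add: second_difference_def diff_divide_distrib)
qed

lemma second_difference_derivative:
  assumes "\<And>y. (f has_real_derivative f' y) (at y)"
  shows "(second_difference h f has_real_derivative second_difference h f' x) (at x)"
proof -
  have "((\<lambda>x. f (x - h)) has_real_derivative f' (x - h)) (at x)"
    "((\<lambda>x. f (x + h)) has_real_derivative f' (x + h)) (at x)"
    using DERIV_shift[of f "f' (x - h)" x "- h"] DERIV_shift[of f "f' (x + h)" x h] assms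
    by simp_all
  then have "((\<lambda>x. (f (x - h) - 2 * f x + f (x + h)) / h\<^sup>2)
      has_real_derivative (f' (x - h) - 2 * f' x + f' (x + h)) / h\<^sup>2) (at x)"
    using assms by (intro DERIV_cdivide DERIV_add DERIV_diff DERIV_cmult)
  then show ?thesis by (simp add: second_difference_def[abs_def])
qed

text \<open>Second differences commute with differentiation, so the second derivative of
  \<open>second_difference h (f 0)\<close> is \<open>second_difference h (f 2)\<close>. The simple
  bound applies twice, giving 2 * 2 = 4.\<close>

lemma second_difference_twice_bound:
  fixes f :: "nat \<Rightarrow> real \<Rightarrow> real"
  assumes f: "\<And>i y. i \<le> 3 \<Longrightarrow> (f i has_real_derivative f (Suc i) y) (at y)"
    and K: "\<And>y. \<bar>f 4 y\<bar> \<le> K" and h: "h > 0"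
  shows "\<bar>second_difference h (second_difference h (f 0)) x\<bar> \<le> 4 * K"
proof -
  have "\<bar>second_difference h (f 2) y\<bar> \<le> 2 * K" for y
    using second_difference_bound[of "\<lambda>i. f (i + 2)" K h y] f[of "_ + 2"] K h
    by (simp add: eval_nat_numeral)
  then show ?thesis
    using second_difference_bound[of "\<lambda>i. second_difference h (f i)" "2 * K" h x] h
    by (simp add: second_difference_derivative f)
qed

text \<open>With \<open>G 0\<close> the error of one second difference, the total error is the
  second difference of \<open>G 0\<close> plus \<open>G 2\<close>. Both are controlled by the bound
  on \<open>G 2\<close>, which gives 2 / 3 + 1 / 3 = 1 and costs six derivatives only.\<close>

lemma second_difference_twice_error:
  fixes f :: "nat \<Rightarrow> real \<Rightarrow> real"
  assumes f: "\<And>i y. i \<le> 5 \<Longrightarrow> (f i has_real_derivative f (Suc i) y) (at y)"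
    and K: "\<And>y. \<bar>f 6 y\<bar> \<le> K" and h: "h > 0"
  shows "\<bar>second_difference h (second_difference h (f 0)) x - f 4 x\<bar> \<le> K * h\<^sup>2"
proof -
  define G where "G i y = second_difference h (f i) y - f (i + 2) y" for i y
  have G2: "\<bar>G 2 y\<bar> \<le> K * h\<^sup>2 / 3" for y
    using second_difference_error[of "\<lambda>i. f (i + 2)" K h y] f[of "_ + 2"] K h
    by (simp add: G_def eval_nat_numeral)
  have "(G i has_real_derivative G (Suc i) y) (at y)" if "i \<le> 1" for i y
    unfolding G_def using that f[of "i + 2"]
    by (auto intro!: derivative_intros second_difference_derivative f)
  then have 1: "\<bar>second_difference h (G 0) x\<bar> \<le> 2 * (K * h\<^sup>2 / 3)"
    using second_difference_bound[of G "K * h\<^sup>2 / 3" h x] G2 h by simp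
  have "second_difference h (G 0) x
      = second_difference h (second_difference h (f 0)) x - second_difference h (f 2) x"
    unfolding second_difference_def[of h _ x] G_def
    by (simp add: diff_divide_distrib add_divide_distrib eval_nat_numeral)
  moreover have "G 2 x = second_difference h (f 2) x - f 4 x"
    by (simp add: G_def)
  ultimately show ?thesis using 1 G2[of x] by linarith
qed

lemma lap_eq_second_difference:
  "lap h (\<lambda>i. f (of_int i * h)) = (\<lambda>i. second_difference h f (of_int i * h))"
  by (auto simp: lap_def second_difference_def algebra_simps)

section \<open>Truncation error\<close>

text \<open>The functions \<open>u m\<close> are the \<open>\<sigma>\<close>-derivatives of the solution at the half step and \<open>w m\<close>
  those of its Crank--Nicolson average.\<close>

lemma truncation_error:
  fixes u w :: "nat \<Rightarrow> real \<Rightarrow> real"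
  assumes u: "\<And>i y. i \<le> 5 \<Longrightarrow> (u i has_real_derivative u (Suc i) y) (at y)"
    and w: "\<And>i y. i \<le> 5 \<Longrightarrow> (w i has_real_derivative w (Suc i) y) (at y)"
    and uK: "\<And>i y. i \<le> 6 \<Longrightarrow> \<bar>u i y\<bar> \<le> K" and wK: "\<And>y. \<bar>w 0 y\<bar> \<le> K"
    and diff: "\<And>i y. i \<le> 4 \<Longrightarrow> \<bar>w i y - u i y\<bar> \<le> K * k\<^sup>2 / 4"
    and params: "\<delta> > 0" "0 < R0" "R0 \<le> r" "h > 0"
    and eq: "\<And>y. ut y + \<delta> / r ^ 4 * u 4 y + 1 / r\<^sup>2 * (\<alpha> - 1 + \<delta> / r\<^sup>2) * u 2 y
        + (\<alpha> - 1) / r\<^sup>2 * u 0 y - vc / r\<^sup>2 * u 0 y * u 1 y = 0"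
    and q: "\<And>y. \<bar>q y - ut y\<bar> \<le> K * k\<^sup>2"
  shows "\<bar>q (of_int i * h) + L_h \<delta> \<alpha> h r (\<lambda>i. w 0 (of_int i * h)) i
      - vc / (6 * h * r\<^sup>2) * phi (\<lambda>i. w 0 (of_int i * h)) (\<lambda>i. w 0 (of_int i * h)) i\<bar>
    \<le> K * (1 + \<delta> / R0 ^ 4 + (\<bar>\<alpha> - 1\<bar> + \<delta> / R0\<^sup>2) / R0\<^sup>2 + \<bar>\<alpha> - 1\<bar> / R0\<^sup>2 + 2 * K)
      * (1 + \<bar>vc\<bar> / r\<^sup>2) * (k\<^sup>2 + h\<^sup>2)"
proof -
  define x where "x = of_int i * h"
  \<comment> \<open>Splitting \<open>w = u + g\<close> separates the two orders: differences of
    \<open>g\<close> are of size \<open>k\<^sup>2\<close>, as its derivatives up to order four are,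
    while differences of \<open>u\<close> have errors of size \<open>h\<^sup>2\<close>.\<close>
  define g where "g j y = w j y - u j y" for j y
  define E where "E = K * (k\<^sup>2 + h\<^sup>2)"
  define \<beta> where "\<beta> = \<alpha> - 1 + \<delta> / r\<^sup>2"
  have K: "K \<ge> 0" using wK[of 0] by linarith
  have r: "r > 0" using params by simp
  have r2: "R0\<^sup>2 \<le> r\<^sup>2" "R0 ^ 4 \<le> r ^ 4" using params by (simp_all add: power_mono)
  have E: "K * k\<^sup>2 \<le> E" "K * h\<^sup>2 \<le> E" "0 \<le> E" "E = K * k\<^sup>2 + K * h\<^sup>2" "0 \<le> K * k\<^sup>2" "0 \<le> K * h\<^sup>2"
    using K by (auto simp: E_def distrib_left)
  have g: "(g j has_real_derivative g (Suc j) y) (at y)" if "j \<le> 5" for j y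
    unfolding g_def using that by (intro derivative_intros u w)
  have gK: "\<bar>g j y\<bar> \<le> K * k\<^sup>2 / 4" if "j \<le> 4" for j y
    using diff[OF that] by (simp add: g_def)
  have D4: "\<bar>second_difference h (second_difference h (w 0)) x - u 4 x\<bar> \<le> E"
  proof -
    have "second_difference h (second_difference h (g 0)) x
      = second_difference h (second_difference h (w 0)) x - second_difference h (second_difference h (u 0)) x"
      by (simp add: second_difference_def g_def diff_divide_distrib add_divide_distrib)
    moreover have "\<bar>second_difference h (second_difference h (g 0)) x\<bar> \<le> 4 * (K * k\<^sup>2 / 4)"
      by (rule second_difference_twice_bound) (use g gK params in auto)
    moreover have "\<bar>second_difference h (second_difference h (u 0)) x - u 4 x\<bar> \<le> K * h\<^sup>2"
      by (rule second_difference_twice_error) (use u uK params in auto)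
    ultimately show ?thesis using E by linarith
  qed
  have D2: "\<bar>second_difference h (w 0) x - u 2 x\<bar> \<le> E"
  proof -
    have "second_difference h (g 0) x = second_difference h (w 0) x - second_difference h (u 0) x"
      by (simp add: second_difference_def g_def diff_divide_distrib add_divide_distrib)
    moreover have "\<bar>second_difference h (g 0) x\<bar> \<le> 2 * (K * k\<^sup>2 / 4)"
      by (rule second_difference_bound) (use g gK params in auto)
    moreover have "\<bar>second_difference h (u 0) x - u 2 x\<bar> \<le> K * h\<^sup>2 / 3"
      by (rule second_difference_error) (use u uK params in auto)
    ultimately show ?thesis using E by linarith
  qed
  have D0: "\<bar>w 0 x - u 0 x\<bar> \<le> E"
    using gK[of 0 x] E by (simp add: g_def)
  \<comment> \<open>\<open>phi\<close> of the values of \<open>w 0\<close> is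
    \<open>6 * h * (A * D)\<close>, a mean value times a centred difference; this explains the
    factor \<open>6 * h\<close> of the scheme.\<close>
  define A where "A = (w 0 (x - h) + w 0 x + w 0 (x + h)) / 3"
  define D where "D = (w 0 (x + h) - w 0 (x - h)) / (2 * h)"
  have A: "\<bar>A - u 0 x\<bar> \<le> E"
  proof -
    have "\<bar>u 0 (x - h) + u 0 (x + h) - 2 * u 0 x\<bar> \<le> 2 * (K * h\<^sup>2)"
      using two_point_average[of UNIV x h u K] u uK by (simp add: abs_le_iff field_simps)
    moreover have "3 * A - 3 * u 0 x = g 0 (x - h) + g 0 x + g 0 (x + h)
        + (u 0 (x - h) + u 0 (x + h) - 2 * u 0 x)"
      by (simp add: A_def g_def)
    ultimately show ?thesis
      using gK[OF le0, of "x - h"] gK[OF le0, of x] gK[OF le0, of "x + h"] E by linarith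
  qed
  have AK: "\<bar>A\<bar> \<le> K"
  proof -
    have "3 * A = w 0 (x - h) + w 0 x + w 0 (x + h)" by (simp add: A_def)
    then show ?thesis using wK[of "x - h"] wK[of x] wK[of "x + h"] by linarith
  qed
  have D: "\<bar>D - u 1 x\<bar> \<le> E"
  proof -
    have 1: "\<bar>(u 0 (x + h) - u 0 (x - h)) / (2 * h) - u 1 x\<bar> \<le> K * h\<^sup>2 / 2"
      using central_difference[of UNIV x h u K] u uK params by simp
    \<comment> \<open>The mean value inequality with \<open>g 1\<close> provides a factor
      \<open>h\<close>; bounding the two values of \<open>g 0\<close> separately would leave
      \<open>k\<^sup>2 / h\<close>.\<close>
    have "\<bar>g 0 (x + h) - g 0 (x - h)\<bar> \<le> (K * k\<^sup>2 / 4) * \<bar>(x + h) - (x - h)\<bar>"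
      using field_differentiable_bound[of UNIV "g 0" "g 1" "K * k\<^sup>2 / 4" "x + h" "x - h"] g[of 0] gK[of 1]
      by simp
    then have 2: "\<bar>(g 0 (x + h) - g 0 (x - h)) / (2 * h)\<bar> \<le> K * k\<^sup>2 / 4"
      using params by (simp add: abs_divide divide_le_eq mult_ac)
    have "D - u 1 x = (g 0 (x + h) - g 0 (x - h)) / (2 * h)
        + ((u 0 (x + h) - u 0 (x - h)) / (2 * h) - u 1 x)"
      by (simp add: D_def g_def diff_divide_distrib)
    with 1 2 E show ?thesis by linarith
  qed
  have AD: "\<bar>A * D - u 0 x * u 1 x\<bar> \<le> 2 * K * E"
  proof -
    have "A * D - u 0 x * u 1 x = A * (D - u 1 x) + (A - u 0 x) * u 1 x"
      by (simp add: algebra_simps)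
    moreover have "\<bar>A * (D - u 1 x)\<bar> \<le> K * E" "\<bar>(A - u 0 x) * u 1 x\<bar> \<le> K * E"
      using AK A D uK[of 1 x] K E unfolding abs_mult mult.commute[of "\<bar>A - u 0 x\<bar>"]
      by (auto intro!: mult_mono)
    ultimately show ?thesis by linarith
  qed
  define \<Gamma> where "\<Gamma> = \<delta> / R0 ^ 4 + (\<bar>\<alpha> - 1\<bar> + \<delta> / R0\<^sup>2) / R0\<^sup>2 + \<bar>\<alpha> - 1\<bar> / R0\<^sup>2"
  have \<Gamma>: "0 \<le> \<Gamma>" using params by (simp add: \<Gamma>_def)
  have c4: "\<bar>\<delta> / r ^ 4\<bar> \<le> \<delta> / R0 ^ 4"
    using r2 params r by (auto simp: abs_divide intro!: divide_left_mono)
  have c0: "\<bar>(\<alpha> - 1) / r\<^sup>2\<bar> \<le> \<bar>\<alpha> - 1\<bar> / R0\<^sup>2"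
    using r2 params r by (auto simp: abs_divide intro!: divide_left_mono)
  have "\<delta> / r\<^sup>2 \<le> \<delta> / R0\<^sup>2" "0 \<le> \<delta> / r\<^sup>2"
    using params r2 r by (auto intro!: divide_left_mono)
  then have "\<bar>\<beta>\<bar> \<le> \<bar>\<alpha> - 1\<bar> + \<delta> / R0\<^sup>2"
    unfolding \<beta>_def by linarith
  then have c2: "\<bar>\<beta> / r\<^sup>2\<bar> \<le> (\<bar>\<alpha> - 1\<bar> + \<delta> / R0\<^sup>2) / R0\<^sup>2"
    unfolding abs_divide using r2 params by (intro frac_le) auto
  have lap_w: "L_h \<delta> \<alpha> h r (\<lambda>i. w 0 (of_int i * h)) i
      = \<delta> / r ^ 4 * second_difference h (second_difference h (w 0)) x
        + \<beta> / r\<^sup>2 * second_difference h (w 0) x + (\<alpha> - 1) / r\<^sup>2 * w 0 x"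
    unfolding L_h_def lap_eq_second_difference
    by (simp add: lap_eq_second_difference x_def \<beta>_def)
  have phi_w: "vc / (6 * h * r\<^sup>2) * phi (\<lambda>i. w 0 (of_int i * h)) (\<lambda>i. w 0 (of_int i * h)) i
      = vc / r\<^sup>2 * (A * D)"
    using params by (simp add: phi_def A_def D_def x_def left_diff_distrib distrib_right)
  have split: "q x + L_h \<delta> \<alpha> h r (\<lambda>i. w 0 (of_int i * h)) i
      - vc / (6 * h * r\<^sup>2) * phi (\<lambda>i. w 0 (of_int i * h)) (\<lambda>i. w 0 (of_int i * h)) i
    = (q x - ut x) + \<delta> / r ^ 4 * (second_difference h (second_difference h (w 0)) x - u 4 x)
      + \<beta> / r\<^sup>2 * (second_difference h (w 0) x - u 2 x) + (\<alpha> - 1) / r\<^sup>2 * (w 0 x - u 0 x)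
      - vc / r\<^sup>2 * (A * D - u 0 x * u 1 x)"
  proof -
    \<comment> \<open>Subtracting the differential equation at the half step leaves only the
      differences estimated above.\<close>
    have "ut x + \<delta> / r ^ 4 * u 4 x + \<beta> / r\<^sup>2 * u 2 x + (\<alpha> - 1) / r\<^sup>2 * u 0 x
        - vc / r\<^sup>2 * (u 0 x * u 1 x) = 0"
      using eq[of x] by (simp add: \<beta>_def mult.assoc)
    then show ?thesis
      unfolding lap_w phi_w right_diff_distrib by linarith
  qed
  have b4: "\<bar>\<delta> / r ^ 4 * (second_difference h (second_difference h (w 0)) x - u 4 x)\<bar>
      \<le> \<delta> / R0 ^ 4 * E"
    unfolding abs_mult using c4 D4 params by (intro mult_mono) auto
  have b2: "\<bar>\<beta> / r\<^sup>2 * (second_difference h (w 0) x - u 2 x)\<bar>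
      \<le> (\<bar>\<alpha> - 1\<bar> + \<delta> / R0\<^sup>2) / R0\<^sup>2 * E"
    unfolding abs_mult using c2 D2 params by (intro mult_mono) auto
  have b0: "\<bar>(\<alpha> - 1) / r\<^sup>2 * (w 0 x - u 0 x)\<bar> \<le> \<bar>\<alpha> - 1\<bar> / R0\<^sup>2 * E"
    unfolding abs_mult using c0 D0 params by (intro mult_mono) auto
  have b1: "\<bar>vc / r\<^sup>2 * (A * D - u 0 x * u 1 x)\<bar> \<le> \<bar>vc\<bar> / r\<^sup>2 * (2 * K * E)"
    unfolding abs_mult using AD by (intro mult_mono) (auto simp: abs_divide)
  have bq: "\<bar>q x - ut x\<bar> \<le> E"
    using q[of x] E by linarith
  have triangle: "\<bar>a + b + c + d - e\<bar> \<le> a' + (b' + c' + d') + e'"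
    if "\<bar>a\<bar> \<le> a'" "\<bar>b\<bar> \<le> b'" "\<bar>c\<bar> \<le> c'" "\<bar>d\<bar> \<le> d'" "\<bar>e\<bar> \<le> e'"
    for a b c d e a' b' c' d' e' :: real
    using that by linarith
  have "\<bar>q x + L_h \<delta> \<alpha> h r (\<lambda>i. w 0 (of_int i * h)) i
      - vc / (6 * h * r\<^sup>2) * phi (\<lambda>i. w 0 (of_int i * h)) (\<lambda>i. w 0 (of_int i * h)) i\<bar>
    \<le> E + (\<delta> / R0 ^ 4 * E + (\<bar>\<alpha> - 1\<bar> + \<delta> / R0\<^sup>2) / R0\<^sup>2 * E + \<bar>\<alpha> - 1\<bar> / R0\<^sup>2 * E)
      + \<bar>vc\<bar> / r\<^sup>2 * (2 * K * E)"
    unfolding split by (rule triangle[OF bq b4 b2 b0 b1])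
  also have "\<dots> = (1 + \<Gamma>) * E + (\<bar>vc\<bar> / r\<^sup>2) * (2 * K) * E"
    by (simp add: \<Gamma>_def distrib_right)
  also have "\<dots> \<le> (1 + \<Gamma> + 2 * K) * (1 + \<bar>vc\<bar> / r\<^sup>2) * E"
  proof -
    \<comment> \<open>The bound is enlarged to a product so that the truncation error carries the
      weight \<open>1 + \<bar>vc\<bar> / r\<^sup>2\<close> used in Gronwall's inequality.\<close>
    have "(1 + \<Gamma>) + (\<bar>vc\<bar> / r\<^sup>2) * (2 * K) \<le> (1 + \<Gamma> + 2 * K) * (1 + \<bar>vc\<bar> / r\<^sup>2)"
    proof -
      have "(1 + \<Gamma> + 2 * K) * (1 + s) = (1 + \<Gamma>) + s * (2 * K) + (2 * K + (1 + \<Gamma>) * s)" for s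
        by (simp add: algebra_simps)
      moreover have "0 \<le> 2 * K + (1 + \<Gamma>) * (\<bar>vc\<bar> / r\<^sup>2)" using \<Gamma> K by simp
      ultimately show ?thesis by simp
    qed
    from mult_right_mono[OF this E(3)] show ?thesis by (simp add: distrib_right)
  qed
  finally show ?thesis
    unfolding x_def[symmetric] by (simp add: \<Gamma>_def E_def mult_ac add_ac)
qed

section \<open>Smooth functions on the strip\<close>

text \<open>\<open>C_class\<close> peels derivatives off from the inside, while the iterate adds
  them outside; hence the induction with arbitrary \<open>q\<close>.\<close>

lemma C_class_dsigma_iterate: "C_class (p + q) T v \<Longrightarrow> C_class q T ((dsigma ^^ p) v)"
proof (induction p arbitrary: q)
  case (Suc p)
  from Suc.IH[of "Suc q"] Suc.prems show ?case by simp
qed simp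

lemma C_class_dtime_iterate: "C_class (p + q) T v \<Longrightarrow> C_class q T ((dtime T ^^ p) v)"
proof (induction p arbitrary: q)
  case (Suc p)
  from Suc.IH[of "Suc q"] Suc.prems show ?case by simp
qed simp

lemma C_bound_dsigma_iterate: "C_bound (p + q) T K v \<Longrightarrow> C_bound q T K ((dsigma ^^ p) v)"
proof (induction p arbitrary: q)
  case (Suc p)
  from Suc.IH[of "Suc q"] Suc.prems show ?case by simp
qed simp

lemma C_bound_dtime_iterate: "C_bound (p + q) T K v \<Longrightarrow> C_bound q T K ((dtime T ^^ p) v)"
proof (induction p arbitrary: q)
  case (Suc p)
  from Suc.IH[of "Suc q"] Suc.prems show ?case by simp
qed simp

lemma C_boundD: "C_bound p T K v \<Longrightarrow> t \<in> {0..T} \<Longrightarrow> \<bar>v \<sigma> t\<bar> \<le> K"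
  by (cases p) auto

lemma C_class_has_dsigma:
  assumes "C_class (Suc p) T v" "t \<in> {0..T}"
  shows "((\<lambda>s. v s t) has_real_derivative dsigma v \<sigma> t) (at \<sigma>)"
proof -
  have "(\<lambda>s. v s t) differentiable (at \<sigma>)" using assms by simp
  then show ?thesis
    unfolding dsigma_def using DERIV_deriv_iff_real_differentiable by blast
qed

lemma C_class_has_dtime:
  assumes "C_class (Suc p) T v" "t \<in> {0..T}"
  shows "((\<lambda>s. v \<sigma> s) has_real_derivative dtime T v \<sigma> t) (at t within {0..T})"
proof -
  have "(\<lambda>s. v \<sigma> s) differentiable (at t within {0..T})" using assms by simp
  then show ?thesis
    unfolding dtime_def has_real_derivative_iff_has_vector_derivative vector_derivative_works .
qed

lemma dsigma_iterate_derivative: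
  assumes "C_class p T v" "t \<in> {0..T}" "i < p"
  shows "((\<lambda>s. (dsigma ^^ i) v s t) has_real_derivative (dsigma ^^ Suc i) v \<sigma> t) (at \<sigma>)"
proof -
  obtain q where "p = i + Suc q" using assms(3) by (metis add_Suc_right less_imp_Suc_add)
  then show ?thesis
    using C_class_has_dsigma[OF C_class_dsigma_iterate] assms by simp
qed

lemma dtime_iterate_derivative:
  assumes "C_class p T v" "t \<in> {0..T}" "i < p"
  shows "((\<lambda>s. (dtime T ^^ i) v \<sigma> s) has_real_derivative (dtime T ^^ Suc i) v \<sigma> t)
    (at t within {0..T})"
proof -
  obtain q where "p = i + Suc q" using assms(3) by (metis add_Suc_right less_imp_Suc_add)
  then show ?thesis
    using C_class_has_dtime[OF C_class_dtime_iterate] assms by simp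
qed

lemma dsigma_iterate_bound:
  assumes "C_bound p T K v" "t \<in> {0..T}" "i \<le> p"
  shows "\<bar>(dsigma ^^ i) v \<sigma> t\<bar> \<le> K"
  using C_boundD[OF C_bound_dsigma_iterate[of i "p - i" T K v]] assms by simp

lemma dtime_iterate_bound:
  assumes "C_bound p T K v" "t \<in> {0..T}" "i \<le> p"
  shows "\<bar>(dtime T ^^ i) v \<sigma> t\<bar> \<le> K"
  using C_boundD[OF C_bound_dtime_iterate[of i "p - i" T K v]] assms by simp

text \<open>Averaging in time costs two time derivatives on top of the \<open>i\<close> spatial
  ones. For \<open>i = 4\<close> this exhausts the six available orders.\<close>

lemma dsigma_time_average:
  assumes C: "C_class (i + 2) T v" and B: "C_bound (i + 2) T K v"
    and t: "t - d \<in> {0..T}" "t \<in> {0..T}" "t + d \<in> {0..T}"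
  shows "\<bar>((dsigma ^^ i) v \<sigma> (t - d) + (dsigma ^^ i) v \<sigma> (t + d)) / 2 - (dsigma ^^ i) v \<sigma> t\<bar>
    \<le> K * d\<^sup>2"
  using two_point_average[of "{0..T}" t d "\<lambda>j. (dtime T ^^ j) ((dsigma ^^ i) v) \<sigma>" K]
    dtime_iterate_derivative[OF C_class_dsigma_iterate[OF C], of _ _ \<sigma>]
    dtime_iterate_bound[OF C_bound_dsigma_iterate[OF B], of _ 2 \<sigma>] t
  by simp

lemma dtime_difference:
  assumes C: "C_class 3 T v" and B: "C_bound 3 T K v"
    and t: "t - d \<in> {0..T}" "t \<in> {0..T}" "t + d \<in> {0..T}" and d: "d > 0"
  shows "\<bar>(v \<sigma> (t + d) - v \<sigma> (t - d)) / (2 * d) - dtime T v \<sigma> t\<bar> \<le> K * d\<^sup>2 / 2"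
  using central_difference[of "{0..T}" t d "\<lambda>j. (dtime T ^^ j) v \<sigma>" K]
    dtime_iterate_derivative[OF C, of _ _ \<sigma>] dtime_iterate_bound[OF B, of _ 3 \<sigma>] t d
  by simp

lemma C_class_mono: "C_class p T v \<Longrightarrow> q \<le> p \<Longrightarrow> C_class q T v"
proof (induction p arbitrary: q v)
  case (Suc p)
  show ?case
  proof (cases q)
    case (Suc q')
    then show ?thesis using Suc.IH[of _ q'] Suc.prems by simp
  qed (use Suc.prems in simp)
qed simp

lemma C_bound_mono: "C_bound p T K v \<Longrightarrow> q \<le> p \<Longrightarrow> C_bound q T K v"
proof (induction p arbitrary: q v)
  case (Suc p)
  show ?case
  proof (cases q)
    case (Suc q')
    then show ?thesis using Suc.IH[of _ q'] Suc.prems by simp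
  qed (use Suc.prems in simp)
qed simp

section \<open>Gronwall's inequality and the radius\<close>

text \<open>The weights \<open>q n\<close> act as variable time steps. With
  \<open>x = \<Lambda> * q n / 2\<close>, the explicit half of a step contributes the factor
  \<open>1 + x\<close> and the implicit half at most \<open>1 + 2 * x\<close>. Their product is at
  most \<open>exp (3 * x)\<close>, whence the 3 / 2 in the exponent.\<close>

lemma implicit_gronwall:
  fixes a q :: "nat \<Rightarrow> real"
  assumes "a 0 = 0" and a: "\<And>n. 0 \<le> a n" and q: "\<And>n. n < N \<Longrightarrow> 0 \<le> q n"
    and step: "\<And>n. n < N \<Longrightarrow> a (Suc n) - a n \<le> \<Lambda> * q n * ((a n + a (Suc n)) / 2) + G * q n"
    and small: "\<And>n. n < N \<Longrightarrow> \<Lambda> * q n \<le> 1" and nonneg: "0 \<le> \<Lambda>" "0 \<le> G" and n: "n \<le> N"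
  shows "a n \<le> exp (3 / 2 * \<Lambda> * (\<Sum>m<n. q m)) * (G * (\<Sum>m<n. q m))"
  using n
proof (induction n)
  case (Suc n)
  define x where "x = \<Lambda> * q n / 2"
  define s where "s = (\<Sum>m<n. q m)"
  have n: "n < N" using Suc.prems by simp
  have x: "0 \<le> x" "x \<le> 1 / 2" using q[OF n] small[OF n] nonneg by (auto simp: x_def)
  have s: "0 \<le> s" using q Suc.prems by (auto simp: s_def intro!: sum_nonneg)
  have "a (Suc n) * (1 - x) \<le> a n * (1 + x) + G * q n"
    using step[OF n] by (simp add: x_def field_simps)
  also have "\<dots> \<le> (1 + x) * (a n + G * q n)"
    using x q[OF n] nonneg by (simp add: algebra_simps)
  finally have "a (Suc n) * (1 - x) * (1 + 2 * x) \<le> (1 + x) * (a n + G * q n) * (1 + 2 * x)"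
    using x by (intro mult_right_mono) auto
  \<comment> \<open>Division by \<open>1 - x\<close> is replaced by multiplication with
    \<open>1 + 2 * x\<close>; this is where \<open>x \<le> 1 / 2\<close>, that is
    \<open>\<Lambda> * q n \<le> 1\<close>, enters.\<close>
  moreover have "a (Suc n) * 1 \<le> a (Suc n) * ((1 - x) * (1 + 2 * x))"
  proof (intro mult_left_mono a)
    have "0 \<le> x * (1 - 2 * x)" using x by simp
    then show "1 \<le> (1 - x) * (1 + 2 * x)" by (simp add: algebra_simps)
  qed
  ultimately have "a (Suc n) \<le> ((1 + x) * (1 + 2 * x)) * (a n + G * q n)"
    by (simp add: mult_ac)
  also have "\<dots> \<le> (exp x * exp (2 * x)) * (a n + G * q n)"
    using x a[of n] q[OF n] nonneg by (intro mult_right_mono mult_mono) auto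
  also have "exp x * exp (2 * x) = exp (3 / 2 * \<Lambda> * q n)"
    by (simp add: exp_add[symmetric] x_def)
  also have "exp (3 / 2 * \<Lambda> * q n) * (a n + G * q n)
      \<le> exp (3 / 2 * \<Lambda> * q n) * (exp (3 / 2 * \<Lambda> * s) * (G * s) + exp (3 / 2 * \<Lambda> * s) * (G * q n))"
  proof (intro mult_left_mono add_mono)
    show "a n \<le> exp (3 / 2 * \<Lambda> * s) * (G * s)"
      using Suc by (simp add: s_def)
    have "1 \<le> exp (3 / 2 * \<Lambda> * s)" using s nonneg by simp
    from mult_right_mono[OF this, of "G * q n"]
    show "G * q n \<le> exp (3 / 2 * \<Lambda> * s) * (G * q n)" using q[OF n] nonneg by simp
  qed simp
  also have "\<dots> = exp (3 / 2 * \<Lambda> * (s + q n)) * (G * (s + q n))"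
    by (simp only: distrib_left exp_add) (simp add: algebra_simps)
  finally show ?case by (simp add: s_def)
qed (use assms in simp)

section \<open>Monotonicity of the radius and the weights it induces\<close>

lemma expanding_radius_mono:
  assumes "expanding_radius \<alpha> vc R0 T R" "0 \<le> s" "s \<le> t" "t \<le> T"
  shows "R s \<le> R t"
proof (cases "s = t")
  case False
  have "\<exists>z\<in>{s<..<t}. R t - R s = (vc + (\<alpha> - 1) / R z) * (t - s)"
  proof (rule mvt_simple)
    fix z assume "s \<le> z" "z \<le> t"
    then have "(R has_real_derivative (vc + (\<alpha> - 1) / R z)) (at z within {0..T})"
      using assms by (simp add: expanding_radius_def)
    then have "(R has_real_derivative (vc + (\<alpha> - 1) / R z)) (at z within {s..t})"
      by (rule DERIV_subset) (use assms in auto)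
    then show "(R has_derivative (*) (vc + (\<alpha> - 1) / R z)) (at z within {s..t})"
      by (simp add: has_field_derivative_def)
  qed (use assms False in auto)
  then obtain z where "z \<in> {s<..<t}" "R t - R s = (vc + (\<alpha> - 1) / R z) * (t - s)" by blast
  moreover have "vc + (\<alpha> - 1) / R z > 0"
    using assms calculation(1) by (simp add: expanding_radius_def)
  ultimately have "0 < R t - R s" by simp
  then show ?thesis by simp
qed simp

lemma expanding_radius_ge:
  assumes "expanding_radius \<alpha> vc R0 T R" "0 \<le> t" "t \<le> T"
  shows "R0 \<le> R t"
  using expanding_radius_mono[OF assms(1) order.refl assms(2,3)] assms(1)
  by (simp add: expanding_radius_def)

text \<open>From \<open>vc / R\<^sup>2 = - (1 / R)' - (\<alpha> - 1) / R\<^sup>3\<close> the weights \<open>\<bar>vc\<bar> / R\<^sup>2\<close> have an integral bounded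
  uniformly in \<open>vc\<close>; this is what keeps the final constant independent of \<open>vc\<close>.\<close>

lemma expanding_radius_weight:
  assumes E: "expanding_radius \<alpha> vc R0 T R" and "R0 > 0" "0 \<le> t - d" "t + d \<le> T" "d > 0"
  shows "d * (\<bar>vc\<bar> / (R t)\<^sup>2) \<le> 1 / R (t - d) - 1 / R (t + d) + d * (\<bar>\<alpha> - 1\<bar> / R0 ^ 3)"
proof -
  have pos: "R s > 0" if "0 \<le> s" "s \<le> T" for s
    using E that by (simp add: expanding_radius_def)
  have mono: "R s \<le> R s'" if "0 \<le> s" "s \<le> s'" "s' \<le> T" for s s'
    using expanding_radius_mono[OF E that] .
  have ge: "R0 \<le> R s" if "0 \<le> s" "s \<le> T" for s
    using expanding_radius_ge[OF E that] .
  have le: "1 / R (t + d) \<le> 1 / R t" "1 / R t \<le> 1 / R (t - d)"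
    using mono[of t "t + d"] mono[of "t - d" t] pos[of "t - d"] pos[of t] assms
    by (auto intro!: divide_left_mono)
  have cube: "\<bar>(\<alpha> - 1) / R z ^ 3\<bar> \<le> \<bar>\<alpha> - 1\<bar> / R0 ^ 3" if "0 \<le> z" "z \<le> T" for z
    using ge[OF that] pos[OF that] assms unfolding abs_divide
    by (intro divide_left_mono) (auto intro!: power_mono)
  show ?thesis
  proof (cases "vc \<le> 0")
    case True
    have t: "0 \<le> t" "t \<le> T" using assms by auto
    \<comment> \<open>For \<open>vc \<le> 0\<close> the radius can expand only if
      \<open>(\<alpha> - 1) / R t\<close> outweighs \<open>\<bar>vc\<bar>\<close>, so the last term
      alone dominates the weight.\<close>
    have "vc + (\<alpha> - 1) / R t > 0" using E t by (simp add: expanding_radius_def)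
    then have "\<bar>vc\<bar> \<le> (\<alpha> - 1) / R t" using True by simp
    then have "\<bar>vc\<bar> / (R t)\<^sup>2 \<le> (\<alpha> - 1) / R t / (R t)\<^sup>2" by (rule divide_right_mono) simp
    also have "\<dots> = (\<alpha> - 1) / R t ^ 3" by (simp add: eval_nat_numeral)
    also have "\<dots> \<le> \<bar>\<alpha> - 1\<bar> / R0 ^ 3" using cube[OF t] by linarith
    finally have "d * (\<bar>vc\<bar> / (R t)\<^sup>2) \<le> d * (\<bar>\<alpha> - 1\<bar> / R0 ^ 3)"
      using assms by (intro mult_left_mono) auto
    then show ?thesis using le by linarith
  next
    case False
    \<comment> \<open>Only the left half of the interval is used: the intermediate point
      \<open>z\<close> then precedes \<open>t\<close>, and \<open>R z \<le> R t\<close> compares the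
      weights in the right direction. The nonnegative decrease of \<open>1 / R\<close> over the
      right half is added at the end.\<close>
    have "\<exists>z\<in>{t - d<..<t}. (- 1 / R t) - (- 1 / R (t - d))
        = ((vc + (\<alpha> - 1) / R z) / (R z)\<^sup>2) * (t - (t - d))"
    proof (rule mvt_simple)
      fix z assume z: "t - d \<le> z" "z \<le> t"
      then have "(R has_real_derivative (vc + (\<alpha> - 1) / R z)) (at z within {0..T})" "R z > 0"
        using E assms by (simp_all add: expanding_radius_def)
      then have "(R has_real_derivative (vc + (\<alpha> - 1) / R z)) (at z within {t - d..t})"
        by (elim DERIV_subset) (use assms in auto)
      then have "((\<lambda>z. - 1 / R z) has_real_derivative (vc + (\<alpha> - 1) / R z) / (R z)\<^sup>2)
          (at z within {t - d..t})"
        using \<open>R z > 0\<close> by (auto intro!: derivative_eq_intros simp: power2_eq_square add_divide_distrib diff_divide_distrib)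
      then show "((\<lambda>z. - 1 / R z) has_derivative (*) ((vc + (\<alpha> - 1) / R z) / (R z)\<^sup>2))
          (at z within {t - d..t})"
        by (simp add: has_field_derivative_def)
    qed (use assms in auto)
    then obtain z where z: "t - d < z" "z < t"
      and eq: "1 / R (t - d) - 1 / R t = (vc + (\<alpha> - 1) / R z) / (R z)\<^sup>2 * d"
      by auto
    have zT: "0 \<le> z" "z \<le> T" using z assms by auto
    have Rz: "R z > 0" using pos zT by simp
    have "vc / (R t)\<^sup>2 \<le> vc / (R z)\<^sup>2"
      using mono[of z t] z zT assms False Rz by (intro divide_left_mono power_mono) auto
    also have "\<dots> = (vc + (\<alpha> - 1) / R z) / (R z)\<^sup>2 - (\<alpha> - 1) / R z ^ 3"
      using Rz by (simp add: add_divide_distrib eval_nat_numeral)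
    also have "\<dots> \<le> (vc + (\<alpha> - 1) / R z) / (R z)\<^sup>2 + \<bar>\<alpha> - 1\<bar> / R0 ^ 3"
      using cube[OF zT] by linarith
    finally have "d * (vc / (R t)\<^sup>2) \<le> d * ((vc + (\<alpha> - 1) / R z) / (R z)\<^sup>2 + \<bar>\<alpha> - 1\<bar> / R0 ^ 3)"
      using assms by (intro mult_left_mono) auto
    also have "\<dots> = (1 / R (t - d) - 1 / R t) + d * (\<bar>\<alpha> - 1\<bar> / R0 ^ 3)"
      unfolding eq by (simp add: algebra_simps)
    finally have "d * (\<bar>vc\<bar> / (R t)\<^sup>2) \<le> (1 / R (t - d) - 1 / R t) + d * (\<bar>\<alpha> - 1\<bar> / R0 ^ 3)"
      using False by simp
    then show ?thesis using le by linarith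
  qed
qed

section \<open>Convergence\<close>

lemma half_step_times:
  assumes "T > 0" "n < N"
  defines "k \<equiv> T / real N"
  defines "t \<equiv> (real n + 1 / 2) * k"
  shows "k > 0" "t - k / 2 = real n * k" "t + k / 2 = real (Suc n) * k"
    "t - k / 2 \<in> {0..T}" "t \<in> {0..T}" "t + k / 2 \<in> {0..T}"
proof -
  show k: "k > 0" using assms by (simp add: k_def)
  show 1: "t - k / 2 = real n * k" and 2: "t + k / 2 = real (Suc n) * k"
    by (simp_all add: t_def algebra_simps)
  have "real (Suc n) * k \<le> real N * k" using assms k by (intro mult_right_mono) auto
  then have "t + k / 2 \<le> T" using assms unfolding 2 by (simp add: k_def)
  moreover have "0 \<le> t - k / 2" using k unfolding 1 by simp
  ultimately show "t - k / 2 \<in> {0..T}" "t \<in> {0..T}" "t + k / 2 \<in> {0..T}"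
    using k by auto
qed

lemma grid_time_mem:
  assumes "T > 0" "n \<le> N"
  shows "real n * (T / real N) \<in> {0..T}"
proof -
  have "real n * (T / real N) \<le> real N * (T / real N)"
    using assms by (intro mult_right_mono) auto
  also have "\<dots> \<le> T" using assms by simp
  finally show ?thesis using assms by simp
qed

lemma grid_values_periodic:
  assumes "exact_solution \<delta> \<alpha> vc T R v" "J > 0" "n \<le> N" "T > 0"
  shows "grid_values v T J N n \<in> periodic_grid J"
proof -
  have "real n * (T / real N) \<in> {0..T}"
    using grid_time_mem assms by blast
  then have "v (\<sigma> + 2 * pi) (real n * (T / real N)) = v \<sigma> (real n * (T / real N))" for \<sigma>
    using assms(1) by (simp add: exact_solution_def)
  moreover have "of_int (i + int J) * mesh J = of_int i * mesh J + 2 * pi" for i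
    using assms by (simp add: mesh_def distrib_right add_divide_distrib)
  ultimately show ?thesis
    by (simp add: periodic_grid_def grid_values_def)
qed

text \<open>The scheme takes the radius at the half step, exactly where the differential equation is
  used, so the coefficients cause no error.\<close>

lemma consistency:
  assumes exact: "exact_solution \<delta> \<alpha> vc T R v" and bound: "C_bound smoothness_order T K v"
    and radius: "expanding_radius \<alpha> vc R0 T R"
    and params: "\<delta> > 0" "R0 > 0" "T > 0" "J > 0" "n < N"
  defines "k \<equiv> T / real N" and "h \<equiv> mesh J"
  defines "r \<equiv> R ((real n + 1 / 2) * k)" and "v' \<equiv> grid_values v T J N"
  shows "\<bar>1 / k * (v' (Suc n) i - v' n i) + L_h \<delta> \<alpha> h r (midpoint_avg v' n) i
      - vc / (6 * h * r\<^sup>2) * phi (midpoint_avg v' n) (midpoint_avg v' n) i\<bar>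
    \<le> K * (1 + \<delta> / R0 ^ 4 + (\<bar>\<alpha> - 1\<bar> + \<delta> / R0\<^sup>2) / R0\<^sup>2 + \<bar>\<alpha> - 1\<bar> / R0\<^sup>2 + 2 * K)
      * (1 + \<bar>vc\<bar> / r\<^sup>2) * (k\<^sup>2 + h\<^sup>2)"
proof -
  define t where "t = (real n + 1 / 2) * k"
  note times = half_step_times[OF params(3,5), folded k_def, folded t_def]
  define u where "u j y = (dsigma ^^ j) v y t" for j y
  define w where "w j y = ((dsigma ^^ j) v y (t - k / 2) + (dsigma ^^ j) v y (t + k / 2)) / 2" for j y
  \<comment> \<open>The divisor is written \<open>2 * (k / 2)\<close> to match the centred
    difference in time with spacing \<open>k / 2\<close>.\<close>
  define q where "q y = (v y (t + k / 2) - v y (t - k / 2)) / (2 * (k / 2))" for y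
  have C: "C_class 6 T v" using exact by (simp add: exact_solution_def)
  have r: "r = R t" by (simp add: r_def t_def)
  have K: "0 \<le> K" using C_boundD[OF bound times(5), of 0] by linarith
  have "v' n i = v (of_int i * h) (t - k / 2)" "v' (Suc n) i = v (of_int i * h) (t + k / 2)" for i
    unfolding times(2,3) by (simp_all add: v'_def grid_values_def k_def h_def)
  then have avg: "midpoint_avg v' n = (\<lambda>i. w 0 (of_int i * h))"
    and quot: "1 / k * (v' (Suc n) i - v' n i) = q (of_int i * h)"
    by (simp_all add: midpoint_avg_def fun_eq_iff w_def q_def)
  show ?thesis unfolding avg quot
  proof (rule truncation_error[where u = u and ut = "\<lambda>y. dtime T v y t"])
    show "(u j has_real_derivative u (Suc j) y) (at y)" if "j \<le> 5" for j y
      unfolding u_def using dsigma_iterate_derivative[OF C times(5), of j] that by simp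
    show "(w j has_real_derivative w (Suc j) y) (at y)" if "j \<le> 5" for j y
      unfolding w_def using dsigma_iterate_derivative[OF C times(4), of j]
        dsigma_iterate_derivative[OF C times(6), of j] that
      by (intro DERIV_cdivide DERIV_add) auto
    show "\<bar>u j y\<bar> \<le> K" if "j \<le> 6" for j y
      unfolding u_def using dsigma_iterate_bound[OF bound times(5) that] .
    show "\<bar>w 0 y\<bar> \<le> K" for y
      using C_boundD[OF bound times(4), of y] C_boundD[OF bound times(6), of y]
      by (simp add: w_def)
    show "\<bar>w j y - u j y\<bar> \<le> K * k\<^sup>2 / 4" if "j \<le> 4" for j y
      using dsigma_time_average[of j T v K t "k / 2" y, OF C_class_mono[OF C] C_bound_mono[OF bound]]
        that times
      by (simp add: w_def u_def power_divide)
    show "\<bar>q y - dtime T v y t\<bar> \<le> K * k\<^sup>2" for y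
    proof -
      have "\<bar>q y - dtime T v y t\<bar> \<le> K * (k / 2)\<^sup>2 / 2"
        unfolding q_def using C_class_mono[OF C, of 3] C_bound_mono[OF bound, of 3] times
        by (intro dtime_difference) auto
      moreover have "0 \<le> K * k\<^sup>2" using K by simp
      ultimately show ?thesis by (simp add: power_divide)
    qed
    show "dtime T v y t + \<delta> / r ^ 4 * u 4 y + 1 / r\<^sup>2 * (\<alpha> - 1 + \<delta> / r\<^sup>2) * u 2 y
        + (\<alpha> - 1) / r\<^sup>2 * u 0 y - vc / r\<^sup>2 * u 0 y * u 1 y = 0" for y
      using exact times(5) by (simp add: exact_solution_def u_def r)
    show "R0 \<le> r" using expanding_radius_ge[OF radius] times(5) by (simp add: r)
    show "h > 0" using params by (simp add: h_def mesh_def)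
  qed (use params in auto)
qed

lemma grid_values_lipschitz:
  assumes "exact_solution \<delta> \<alpha> vc T R v" "\<forall>t\<in>{0..T}. \<forall>\<sigma>. \<bar>dsigma v \<sigma> t\<bar> \<le> M" "T > 0" "n \<le> N"
  shows "\<bar>grid_values v T J N n (i + 1) - grid_values v T J N n i\<bar> \<le> M * mesh J"
proof -
  define t where "t = real n * (T / real N)"
  have t: "t \<in> {0..T}"
    unfolding t_def using grid_time_mem assms by blast
  have "C_class (Suc 5) T v" using assms(1) by (simp add: exact_solution_def)
  from C_class_has_dsigma[OF this t]
  have "norm (v (of_int i * mesh J + mesh J) t - v (of_int i * mesh J) t)
      \<le> M * norm (of_int i * mesh J + mesh J - of_int i * mesh J)"
    by (intro field_differentiable_bound[of UNIV "\<lambda>s. v s t" "\<lambda>s. dsigma v s t"])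
      (use assms(2) t in auto)
  moreover have "\<bar>mesh J\<bar> = mesh J" by (simp add: mesh_def)
  ultimately show ?thesis
    by (simp add: grid_values_def t_def distrib_right)
qed

text \<open>The order of the quantifiers carries the uniformity: \<open>c\<close> depends on the
  fixed parameters, among them \<open>T\<close> and the derivative bound \<open>K\<close>, while
  only the threshold \<open>k0\<close> may depend on \<open>vc\<close>.\<close>

theorem theorem1:
  fixes \<delta> \<alpha> R0 M T K :: real
  assumes "\<delta> > 0" and "\<alpha> > 0" and "R0 > 0" and "M > 0" and "T > 0"
  shows "\<exists>c>0. \<forall>vc. \<exists>k0>0. \<forall>R v J N V.
    expanding_radius \<alpha> vc R0 T R \<longrightarrow>
    exact_solution \<delta> \<alpha> vc T R v \<longrightarrow>
    C_bound smoothness_order T K v \<longrightarrow>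
    (\<forall>t\<in>{0..T}. \<forall>\<sigma>. \<bar>dsigma v \<sigma> t\<bar> \<le> M) \<longrightarrow>
    J > 0 \<longrightarrow> N > 0 \<longrightarrow> T / real N \<le> k0 \<longrightarrow>
    (\<forall>n\<le>N. V n \<in> periodic_grid J) \<longrightarrow>
    (\<forall>n\<le>N. mean_h J (V n) = 0) \<longrightarrow>
    V 0 = grid_values v T J N 0 \<longrightarrow>
    crank_nicolson \<delta> \<alpha> vc T R J N V \<longrightarrow>
    (MAX n\<in>{0..N}. norm_h J (\<lambda>i. grid_values v T J N n i - V n i))
      \<le> c * ((T / real N)\<^sup>2 + (mesh J)\<^sup>2)"
proof -
  define C0 where "C0 = (\<bar>\<alpha> - 1\<bar> + \<delta> / R0\<^sup>2)\<^sup>2 / (4 * \<delta>) + \<bar>\<alpha> - 1\<bar> / R0\<^sup>2"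
  define \<Lambda> where "\<Lambda> = C0 + 3 / 2 * M"
  \<comment> \<open>The sign of \<open>K\<close> is unknown until a solution bounded by
    \<open>K\<close> is given; from then on \<open>\<bar>K\<bar> = K\<close>.\<close>
  define \<Gamma> where "\<Gamma> = \<bar>K\<bar> * (1 + \<delta> / R0 ^ 4 + (\<bar>\<alpha> - 1\<bar> + \<delta> / R0\<^sup>2) / R0\<^sup>2
    + \<bar>\<alpha> - 1\<bar> / R0\<^sup>2 + 2 * \<bar>K\<bar>)"
  \<comment> \<open>A bound for the sum of all weights: \<open>T\<close> from the summand 1,
    \<open>2 / R0\<close> from the telescoping of \<open>1 / R\<close>, and the rest from the
    \<open>\<alpha> - 1\<close> part of the radius equation.\<close>
  define Q where "Q = T + 2 / R0 + T * (\<bar>\<alpha> - 1\<bar> / R0 ^ 3)"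
  \<comment> \<open>The added 1 keeps \<open>c\<close> positive when
    \<open>\<Gamma> = 0\<close>.\<close>
  define c where "c = exp (3 / 2 * \<Lambda> * Q) * (sqrt (2 * pi) * \<Gamma> * Q) + 1"
  have C0: "0 \<le> C0" using assms by (simp add: C0_def)
  have \<Lambda>: "0 < \<Lambda>" using assms C0 by (simp add: \<Lambda>_def)
  have \<Gamma>: "0 \<le> \<Gamma>" using assms by (simp add: \<Gamma>_def)
  have Q: "0 < Q" using assms by (auto simp: Q_def intro!: add_pos_nonneg)
  have c: "0 < c" using \<Gamma> Q by (auto simp: c_def intro!: add_nonneg_pos)
  show ?thesis
  proof (rule exI[of _ c], intro conjI c allI)
    fix vc
    \<comment> \<open>Since the radius is at least \<open>R0\<close>, this makes
      \<open>\<Lambda> * q n \<le> 1\<close>, the smallness condition of Gronwall's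
      inequality.\<close>
    define k0 where "k0 = 1 / (\<Lambda> * (1 + \<bar>vc\<bar> / R0\<^sup>2))"
    have pos: "0 < 1 + \<bar>vc\<bar> / R0\<^sup>2" by (simp add: add_pos_nonneg)
    have k0: "0 < k0" using \<Lambda> pos by (simp add: k0_def)
    show "\<exists>k0>0. \<forall>R v J N V.
      expanding_radius \<alpha> vc R0 T R \<longrightarrow>
      exact_solution \<delta> \<alpha> vc T R v \<longrightarrow>
      C_bound smoothness_order T K v \<longrightarrow>
      (\<forall>t\<in>{0..T}. \<forall>\<sigma>. \<bar>dsigma v \<sigma> t\<bar> \<le> M) \<longrightarrow>
      J > 0 \<longrightarrow> N > 0 \<longrightarrow> T / real N \<le> k0 \<longrightarrow>
      (\<forall>n\<le>N. V n \<in> periodic_grid J) \<longrightarrow>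
      (\<forall>n\<le>N. mean_h J (V n) = 0) \<longrightarrow>
      V 0 = grid_values v T J N 0 \<longrightarrow>
      crank_nicolson \<delta> \<alpha> vc T R J N V \<longrightarrow>
      (MAX n\<in>{0..N}. norm_h J (\<lambda>i. grid_values v T J N n i - V n i))
        \<le> c * ((T / real N)\<^sup>2 + (mesh J)\<^sup>2)"
    proof (rule exI[of _ k0], intro conjI k0 allI impI)
      fix R v J N V
      assume radius: "expanding_radius \<alpha> vc R0 T R"
        and exact: "exact_solution \<delta> \<alpha> vc T R v"
        and bound: "C_bound smoothness_order T K v"
        and M: "\<forall>t\<in>{0..T}. \<forall>\<sigma>. \<bar>dsigma v \<sigma> t\<bar> \<le> M"
        and J: "J > (0::nat)" and N: "N > (0::nat)" and small: "T / real N \<le> k0"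
        and per: "\<forall>n\<le>N. V n \<in> periodic_grid J"
        and init: "V 0 = grid_values v T J N 0"
        and scheme: "crank_nicolson \<delta> \<alpha> vc T R J N V"
      define k where "k = T / real N"
      define h where "h = mesh J"
      define E where "E = k\<^sup>2 + h\<^sup>2"
      define v' where "v' = grid_values v T J N"
      define r where "r n = R ((real n + 1 / 2) * k)" for n :: nat
      define q where "q n = k * (1 + \<bar>vc\<bar> / (r n)\<^sup>2)" for n
      define a where "a n = norm_h J (\<lambda>i. v' n i - V n i)" for n
      have k: "0 < k" using assms N by (simp add: k_def)
      have E: "0 \<le> E" by (simp add: E_def)
      have K: "\<bar>K\<bar> = K" using C_boundD[OF bound, of 0 0] assms by simp
      have r: "R0 \<le> r n" if "n < N" for n
        using expanding_radius_ge[OF radius] half_step_times(5)[OF assms(5) that]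
        by (simp add: r_def k_def)
      have q0: "0 \<le> q n" for n using k by (simp add: q_def)
      have q_small: "\<Lambda> * q n \<le> 1" if "n < N" for n
      proof -
        have "\<bar>vc\<bar> / (r n)\<^sup>2 \<le> \<bar>vc\<bar> / R0\<^sup>2"
          using r[OF that] assms by (intro divide_left_mono power_mono) auto
        then have "q n \<le> k0 * (1 + \<bar>vc\<bar> / R0\<^sup>2)"
          unfolding q_def using small k k0 by (intro mult_mono) (auto simp: k_def)
        then have "\<Lambda> * q n \<le> \<Lambda> * (k0 * (1 + \<bar>vc\<bar> / R0\<^sup>2))"
          using \<Lambda> by (intro mult_left_mono) auto
        also have "\<dots> = 1" using \<Lambda> pos by (simp add: k0_def)
        finally show ?thesis .
      qed
      have q_sum: "(\<Sum>m<n. q m) \<le> Q" if "n \<le> N" for n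
      proof -
        \<comment> \<open>The induction is the telescoping. The factor 2 arises because the estimate
          for a weight is stated for a half step \<open>k / 2\<close>.\<close>
        have "(\<Sum>m<n. q m) \<le> 2 * (1 / R0 - 1 / R (real n * k)) + real n * k * (1 + \<bar>\<alpha> - 1\<bar> / R0 ^ 3)"
          using that
        proof (induction n)
          case 0
          then show ?case using radius by (simp add: expanding_radius_def)
        next
          case (Suc n)
          then have n: "n < N" by simp
          note times = half_step_times[OF assms(5) n, folded k_def]
          have "k / 2 * (\<bar>vc\<bar> / (r n)\<^sup>2) \<le> 1 / R (real n * k) - 1 / R (real (Suc n) * k)
              + k / 2 * (\<bar>\<alpha> - 1\<bar> / R0 ^ 3)"
            unfolding r_def times(2)[symmetric] times(3)[symmetric]
            by (rule expanding_radius_weight[OF radius assms(3)]) (use times(1,4,6) in auto)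
          from mult_left_mono[OF this, of 2]
          have "q n \<le> 2 * (1 / R (real n * k)) - 2 * (1 / R (real (Suc n) * k))
              + k * (1 + \<bar>\<alpha> - 1\<bar> / R0 ^ 3)"
            by (simp add: q_def distrib_left right_diff_distrib)
          moreover have "real (Suc n) * k * (1 + \<bar>\<alpha> - 1\<bar> / R0 ^ 3)
              = real n * k * (1 + \<bar>\<alpha> - 1\<bar> / R0 ^ 3) + k * (1 + \<bar>\<alpha> - 1\<bar> / R0 ^ 3)"
            by (simp only: of_nat_Suc distrib_right mult_1_left add.commute)
          ultimately show ?case using Suc.IH n by simp
        qed
        also have "\<dots> \<le> 2 * (1 / R0) + T * (1 + \<bar>\<alpha> - 1\<bar> / R0 ^ 3)"
        proof (intro add_mono mult_left_mono mult_right_mono)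
          have nk: "0 \<le> real n * k" "real n * k \<le> T"
            using grid_time_mem[OF assms(5) that] by (simp_all add: k_def)
          then show "real n * k \<le> T" by simp
          have "0 < R (real n * k)" using radius nk by (simp add: expanding_radius_def)
          then show "1 / R0 - 1 / R (real n * k) \<le> 1 / R0" by simp
        qed (use assms in auto)
        also have "\<dots> = Q" by (simp add: Q_def algebra_simps)
        finally show ?thesis .
      qed
      have step: "a (Suc n) - a n \<le> \<Lambda> * q n * ((a n + a (Suc n)) / 2) + (sqrt (2 * pi) * \<Gamma> * E) * q n"
        if n: "n < N" for n
      proof -
        define \<tau> where "\<tau> i = 1 / k * (v' (Suc n) i - v' n i) + L_h \<delta> \<alpha> h (r n) (midpoint_avg v' n) i
            - vc / (6 * h * (r n)\<^sup>2) * phi (midpoint_avg v' n) (midpoint_avg v' n) i" for i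
        \<comment> \<open>Shifting the index by \<open>n\<close> turns the step between levels 0 and
          1 into the step from \<open>n\<close> to \<open>Suc n\<close>.\<close>
        have avg: "midpoint_avg (\<lambda>j. f (n + j)) 0 = midpoint_avg f n" for f
          by (simp add: midpoint_avg_def fun_eq_iff)
        have "a (n + 1) - a (n + 0) \<le> k * (C0 + 3 / 2 * M * \<bar>vc\<bar> / (r n)\<^sup>2) * ((a (n + 0) + a (n + 1)) / 2)
            + k * (sqrt (2 * pi) * (\<Gamma> * (1 + \<bar>vc\<bar> / (r n)\<^sup>2) * E))"
          unfolding a_def C0_def
        proof (rule energy_step[where v = "\<lambda>j. v' (n + j)" and V = "\<lambda>j. V (n + j)" and \<tau> = \<tau>,
              unfolded avg])
          show "v' (n + j) \<in> periodic_grid J" if "j \<le> 1" for j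
            unfolding v'_def using grid_values_periodic[OF exact J] assms n that by simp
          show "V (n + j) \<in> periodic_grid J" if "j \<le> 1" for j
            using per n that by simp
          show "1 / k * (V (n + 1) i - V (n + 0) i) + L_h \<delta> \<alpha> (mesh J) (r n) (midpoint_avg V n) i
              = vc / (6 * mesh J * (r n)\<^sup>2) * phi (midpoint_avg V n) (midpoint_avg V n) i" for i
            using scheme n unfolding crank_nicolson_def Let_def k_def[symmetric] r_def[symmetric]
            by simp
          show "1 / k * (v' (n + 1) i - v' (n + 0) i) + L_h \<delta> \<alpha> (mesh J) (r n) (midpoint_avg v' n) i
              = vc / (6 * mesh J * (r n)\<^sup>2) * phi (midpoint_avg v' n) (midpoint_avg v' n) i + \<tau> i" for i
            by (simp add: \<tau>_def h_def)
          show "\<bar>midpoint_avg v' n (i + 1) - midpoint_avg v' n i\<bar> \<le> M * mesh J" for i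
            using grid_values_lipschitz[OF exact M assms(5), of n N J i]
              grid_values_lipschitz[OF exact M assms(5), of "Suc n" N J i] n
            by (simp add: midpoint_avg_def v'_def abs_le_iff field_simps)
          show "\<bar>\<tau> i\<bar> \<le> \<Gamma> * (1 + \<bar>vc\<bar> / (r n)\<^sup>2) * E" for i
            using consistency[OF exact bound radius assms(1,3,5) J n, of i]
            by (simp only: \<tau>_def \<Gamma>_def K E_def v'_def h_def k_def r_def)
        qed (use assms r[OF n] k J in auto)
        moreover have "k * (C0 + 3 / 2 * M * \<bar>vc\<bar> / (r n)\<^sup>2) * ((a n + a (Suc n)) / 2)
            \<le> \<Lambda> * q n * ((a n + a (Suc n)) / 2)"
        proof (rule mult_right_mono)
          \<comment> \<open>Both parts of the rate are absorbed into one multiple of the weight, at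
            the cost of nonnegative cross terms.\<close>
          have "C0 + 3 / 2 * M * \<bar>vc\<bar> / (r n)\<^sup>2 \<le> \<Lambda> * (1 + \<bar>vc\<bar> / (r n)\<^sup>2)"
            using C0 assms by (simp add: \<Lambda>_def algebra_simps)
          from mult_left_mono[OF this, of k]
          show "k * (C0 + 3 / 2 * M * \<bar>vc\<bar> / (r n)\<^sup>2) \<le> \<Lambda> * q n"
            using k by (simp add: q_def mult_ac)
        qed (simp add: a_def)
        moreover have "k * (sqrt (2 * pi) * (\<Gamma> * (1 + \<bar>vc\<bar> / (r n)\<^sup>2) * E)) = (sqrt (2 * pi) * \<Gamma> * E) * q n"
          by (simp add: q_def)
        ultimately show ?thesis unfolding Suc_eq_plus1 add_0_right by linarith
      qed
      have "a n \<le> c * E" if n: "n \<le> N" for n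
      proof -
        have sum0: "0 \<le> (\<Sum>m<n. q m)" using q0 by (simp add: sum_nonneg)
        have "a n \<le> exp (3 / 2 * \<Lambda> * (\<Sum>m<n. q m)) * ((sqrt (2 * pi) * \<Gamma> * E) * (\<Sum>m<n. q m))"
        proof (rule implicit_gronwall[where N = N])
          show "a 0 = 0" by (simp add: a_def v'_def init norm_h_def)
          show "0 \<le> a n" for n by (simp add: a_def)
        qed (use q0 \<Lambda> \<Gamma> E n step q_small in auto)
        also have "\<dots> \<le> exp (3 / 2 * \<Lambda> * Q) * ((sqrt (2 * pi) * \<Gamma> * E) * Q)"
          using q_sum[OF n] sum0 \<Lambda> \<Gamma> E by (intro mult_mono) auto
        also have "\<dots> \<le> c * E"
          using E by (simp add: c_def algebra_simps)
        finally show ?thesis .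
      qed
      then show "(MAX n\<in>{0..N}. norm_h J (\<lambda>i. grid_values v T J N n i - V n i))
          \<le> c * ((T / real N)\<^sup>2 + (mesh J)\<^sup>2)"
        by (auto simp: a_def v'_def E_def k_def h_def)
    qed
  qed
qed

end
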